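(* Consider a $K$-armed stochastic bandit with mean rewards $r(1)>r(2)>\cdots>r(K)$, $a^\star=1$, and features $X\in\mathbb{R}^{K\times d}$, $d\le K$, with rows $x_1,\dots,x_K$. Assume that for all actions $i,j,k\in[K]$ (with $j=k$ allowed) such that $r(i)>r(j)$ and $r(i)>r(k)$, one has $\langle x_i-x_j,\,x_{a^\star}-x_k\rangle>0$ if $i=a^\star$ or $j=k$, and $\langle x_i-x_j,\,x_{a^\star}-x_k\rangle\ge0$ otherwise. Let $\rho=\frac{8R_{\max}^3K^{3/2}}{\Delta^2}$, and let $(\theta_t)_{t\ge1}$ be generated by stochastic softmax policy gradient (defined in the context) with constant learning rate $$0<\eta\le\min\left\{\frac{1}{6\,(\lambda_{\max}(X^\top X))^{3/2}\sqrt{2R_{\max}}},\ \frac{\lambda_{\min}(X^\top X)}{6\,\rho\,[\lambda_{\max}(X^\top X)]^2}\right\}.$$ Then almost surely the policies converge to the optimal policy: $\lim_{t\to\infty}\pi_{\theta_t}(a^\star)=1$.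
   Context: Bandit: $K\ge2$ actions $[K]=\{1,\dots,K\}$; each action $a$ has a reward distribution $P_a$ supported in $[-R_{\max},R_{\max}]$ ($R_{\max}>0$; given by a density with respect to a fixed finite measure on that interval) with mean $r(a)$. $\Delta=\min_{i\ne j}|r(i)-r(j)|>0$. Policies: $\pi_\theta=\mathrm{softmax}(X\theta)$, i.e. $\pi_\theta(a)=\exp(\langle x_a,\theta\rangle)/\sum_{a'}\exp(\langle x_{a'},\theta\rangle)$. Stochastic softmax policy gradient: start from $\theta_1\in\mathbb{R}^d$; at each $t\ge1$, sample $a_t\sim\pi_{\theta_t}$, observe $R_t(a_t)\sim P_{a_t}$ (given the past and $a_t$), set $\hat r_t(a)=\frac{\mathbf 1\{a=a_t\}}{\pi_{\theta_t}(a)}R_t(a_t)$ for each $a\in[K]$, and $\theta_{t+1}=\theta_t+\eta\,X^\top(\mathrm{diag}(\pi_{\theta_t})-\pi_{\theta_t}\pi_{\theta_t}^\top)\,\hat r_t$. $\lambda_{\max},\lambda_{\min}$ denote largest and smallest eigenvalues. *)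

theory Defs
  imports "HOL-Probability.Probability"
begin

definition softmax :: "real ^ 'k \<Rightarrow> real ^ ('k :: finite)" where
  "softmax z = (\<chi> a. exp (z $ a) / (\<Sum>b\<in>UNIV. exp (z $ b)))"

(* The a-th row X $ a is the feature vector of action a, so (X *v th) $ a = X $ a \<bullet> th. *)
definition policy :: "real ^ 'd ^ 'k \<Rightarrow> real ^ 'd \<Rightarrow> real ^ ('k :: finite)" where
  "policy X th = softmax (X *v th)"

definition diag_mat :: "real ^ 'k \<Rightarrow> real ^ 'k ^ ('k :: finite)" where
  "diag_mat v = (\<chi> i j. if i = j then v $ i else 0)"

definition outer_prod :: "real ^ 'k \<Rightarrow> real ^ 'k \<Rightarrow> real ^ 'k ^ ('k :: finite)" where
  "outer_prod u v = (\<chi> i j. u $ i * v $ j)"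

definition eigenvalues :: "real ^ 'n ^ 'n \<Rightarrow> real set" where
  "eigenvalues A = {l. \<exists>v. v \<noteq> 0 \<and> A *v v = l *\<^sub>R v}"

(* Only meant for symmetric matrices: then the set of real eigenvalues is nonempty
   (and, as for every matrix, finite), so Max and Min are attained. *)
definition lambda_max :: "real ^ 'n ^ 'n \<Rightarrow> real" where
  "lambda_max A = Max (eigenvalues A)"

definition lambda_min :: "real ^ 'n ^ 'n \<Rightarrow> real" where
  "lambda_min A = Min (eigenvalues A)"

(* Reward law of action a: density (p a) with respect to nu, a finite measure that is
   carried by the interval [-Rmax, Rmax]. *)
locale bounded_bandit =
  fixes Rmax :: real and nu :: "real measure" and p :: "'k :: finite \<Rightarrow> real \<Rightarrow> ennreal"
  assumes Rmax_pos: "Rmax > 0"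
    and finite_nu: "finite_measure nu"
    and sets_nu: "sets nu = sets borel"
    and nu_support: "emeasure nu (- {-Rmax..Rmax}) = 0"
    and p_measurable: "\<And>a. p a \<in> borel_measurable borel"
    and p_density: "\<And>a. prob_space (density nu (p a))"

definition reward_law :: "real measure \<Rightarrow> ('k \<Rightarrow> real \<Rightarrow> ennreal) \<Rightarrow> 'k \<Rightarrow> real measure" where
  "reward_law nu p a = density nu (p a)"

definition mean_reward :: "real measure \<Rightarrow> ('k \<Rightarrow> real \<Rightarrow> ennreal) \<Rightarrow> 'k \<Rightarrow> real" where
  "mean_reward nu p a = (\<integral>x. x \<partial>reward_law nu p a)"

definition reward_gap :: "('k :: finite \<Rightarrow> real) \<Rightarrow> real" where
  "reward_gap r = Min {\<bar>r i - r j\<bar> | i j. i \<noteq> j}"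

(* Sigma-algebra of the past before round t, generated by (a_s, R_s) for 1 \<le> s < t.
   The initial parameter is deterministic, so theta_t is measurable with respect to it. *)
definition past ::
    "'w measure \<Rightarrow> (nat \<Rightarrow> 'w \<Rightarrow> 'k) \<Rightarrow> (nat \<Rightarrow> 'w \<Rightarrow> real) \<Rightarrow> nat \<Rightarrow> 'w measure" where
  "past M act R t =
     vimage_algebra (space M) (\<lambda>w. \<lambda>s\<in>{1..<t}. (act s w, R s w))
       (Pi\<^sub>M {1..<t} (\<lambda>_. count_space UNIV \<Otimes>\<^sub>M borel))"

(* The past before round t together with the action a_t. *)
definition past_action ::
    "'w measure \<Rightarrow> (nat \<Rightarrow> 'w \<Rightarrow> 'k) \<Rightarrow> (nat \<Rightarrow> 'w \<Rightarrow> real) \<Rightarrow> nat \<Rightarrow> 'w measure" where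
  "past_action M act R t =
     vimage_algebra (space M) (\<lambda>w. (\<lambda>s\<in>{1..<t}. (act s w, R s w), act t w))
       (Pi\<^sub>M {1..<t} (\<lambda>_. count_space UNIV \<Otimes>\<^sub>M borel) \<Otimes>\<^sub>M count_space UNIV)"

(* Importance-weighted reward estimate when action b was played and reward x observed. *)
definition reward_estimate :: "real ^ 'k \<Rightarrow> 'k \<Rightarrow> real \<Rightarrow> real ^ ('k :: finite)" where
  "reward_estimate q b x = (\<chi> a. (if a = b then 1 else 0) / q $ a * x)"

(* Rounds are numbered from 1; the values of act, R and theta at index 0 are irrelevant. *)
locale softmax_pg = prob_space M
  for M :: "'w measure" +
  fixes X :: "real ^ 'd ^ ('k :: finite)" and P :: "'k \<Rightarrow> real measure" and eta :: real
    and theta1 :: "real ^ 'd"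
    and theta :: "nat \<Rightarrow> 'w \<Rightarrow> real ^ 'd"
    and act :: "nat \<Rightarrow> 'w \<Rightarrow> 'k" and R :: "nat \<Rightarrow> 'w \<Rightarrow> real"
  assumes act_measurable: "\<And>t. t \<ge> 1 \<Longrightarrow> act t \<in> measurable M (count_space UNIV)"
    and R_measurable: "\<And>t. t \<ge> 1 \<Longrightarrow> R t \<in> borel_measurable M"
    and act_law: "\<And>t b. t \<ge> 1 \<Longrightarrow>
      AE w in M. real_cond_exp M (past M act R t) (\<lambda>w. indicator {b} (act t w)) w
                 = policy X (theta t w) $ b"
    and R_law: "\<And>t B. t \<ge> 1 \<Longrightarrow> B \<in> sets borel \<Longrightarrow>
      AE w in M. real_cond_exp M (past_action M act R t) (\<lambda>w. indicator B (R t w)) w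
                 = measure (P (act t w)) B"
    and theta_init: "\<And>w. w \<in> space M \<Longrightarrow> theta 1 w = theta1"
    and theta_step: "\<And>t w. t \<ge> 1 \<Longrightarrow> w \<in> space M \<Longrightarrow>
      theta (Suc t) w = theta t w + eta *\<^sub>R
        (transpose X *v
          ((diag_mat (policy X (theta t w)) - outer_prod (policy X (theta t w)) (policy X (theta t w)))
            *v reward_estimate (policy X (theta t w)) (act t w) (R t w)))"

end

theory Submission
  imports Defs
begin

text \<open>
  One step of the algorithm is \<open>\<theta>' = \<theta> + \<eta> R (x\<^sub>a - \<Sum>b. \<pi> b x\<^sub>b)\<close>. For a suboptimal action \<open>j\<close> consider
  the logit gap \<open>Y j = \<langle>x\<^sub>* - x\<^sub>j, \<theta>\<rangle>\<close>, so that \<open>\<pi> j = \<pi>\<^sub>* exp (- Y j)\<close>. Written as a sum over pairs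
  of actions, its conditional drift consists of nonnegative terms that dominate the conditional
  variance, up to terms containing an action worse than \<open>j\<close>. Since \<open>exp x \<le> 1 + x + x\<^sup>2\<close>
  for \<open>x \<le> 1\<close>, the compensated process \<open>exp (- l Y j)\<close> is a supermartingale for small \<open>l > 0\<close>, hence
  almost surely bounded, which yields
  \<open>Y j \<ge> - L + (\<Sum>s. (1 - \<pi>\<^sub>*) (c \<pi>\<^sub>* - C (\<Sum>b worse than j. \<pi> b)))\<close>.

  This inequality is used path by path, by induction from the worst action upwards.
  If \<open>\<Sum> \<pi>\<^sub>* (1 - \<pi>\<^sub>*)\<close> converges, every \<open>Y j\<close> is bounded below, so \<open>\<pi>\<^sub>*\<close> is bounded away from \<open>0\<close> and
  \<open>\<Sum> (1 - \<pi>\<^sub>*)\<close> converges. If it diverges, every \<open>Y j\<close> tends to infinity. In both cases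
  \<open>\<pi>\<^sub>* \<longlonglongrightarrow> 1\<close>.
\<close>

section \<open>Elementary inequalities and uniform constants over finitely many actions\<close>

text \<open>For negative \<open>x = - u\<close>, the product
  \<open>(1 - u + u^2) * (1 + u + u^2 / 2)\<close> has no linear term and is at least
  \<open>1\<close>, while its second factor is a Taylor lower bound of \<open>exp u\<close>.
  Dividing by \<open>exp u\<close> gives the claim.\<close>

lemma exp_le_quadratic:
  fixes x :: real
  assumes "x \<le> 1"
  shows "exp x \<le> 1 + x + x\<^sup>2"
proof (cases "x \<ge> 0")
  case True
  then show ?thesis using exp_bound assms by blast
next
  case False
  define u where "u = - x"
  have u: "u > 0" using False by (simp add: u_def)
  have "1 \<le> (1 - u + u\<^sup>2) * (1 + u + u\<^sup>2 / 2)"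
  proof -
    have "(1 - u + u\<^sup>2) * (1 + u + u\<^sup>2 / 2) = 1 + u\<^sup>2 / 2 + u ^ 3 / 2 + u ^ 4 / 2"
      by (simp add: field_simps power2_eq_square power3_eq_cube power4_eq_xxxx)
    then show ?thesis using u by simp
  qed
  also have "\<dots> \<le> (1 - u + u\<^sup>2) * exp u"
  proof (rule mult_left_mono)
    show "1 + u + u\<^sup>2 / 2 \<le> exp u" using u exp_lower_Taylor_quadratic by simp
    have "0 \<le> (u - 1/2)\<^sup>2 + 3/4" by simp
    then show "0 \<le> 1 - u + u\<^sup>2" by (simp add: power2_eq_square algebra_simps)
  qed
  finally have "exp (- u) \<le> 1 - u + u\<^sup>2"
    by (simp add: exp_minus field_simps)
  then show ?thesis by (simp add: u_def)
qed

text \<open>This turns strict inequalities over finitely many actions or pairs of actions into one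
  uniform gap.\<close>

lemma finite_ex_pos_lower_bound:
  fixes f :: "'a \<Rightarrow> real"
  assumes "finite A" and "\<And>x. x \<in> A \<Longrightarrow> f x > 0"
  shows "\<exists>c>0. \<forall>x\<in>A. c \<le> f x"
  using assms
proof (induction A rule: finite_induct)
  case empty
  then show ?case by (auto intro: exI[of _ 1])
next
  case (insert a A)
  then obtain c where "c > 0" "\<forall>x\<in>A. c \<le> f x" by auto
  then show ?case using insert.prems[of a]
    by (intro exI[of _ "min c (f a)"]) auto
qed

lemma finite_ex_diff_bound:
  fixes g :: "'a::finite \<Rightarrow> real"
  shows "\<exists>B>0. \<forall>a b. \<bar>g a - g b\<bar> \<le> B"
proof (intro exI conjI allI)
  let ?B = "1 + 2 * (\<Sum>c\<in>UNIV. \<bar>g c\<bar>)"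
  show "?B > 0" by (simp add: add_pos_nonneg sum_nonneg)
  fix a b
  have "\<bar>g c\<bar> \<le> (\<Sum>c\<in>UNIV. \<bar>g c\<bar>)" for c
    by (rule member_le_sum) auto
  from this[of a] this[of b] show "\<bar>g a - g b\<bar> \<le> ?B" by linarith
qed

section \<open>Softmax policies\<close>

lemma policy_nth:
  "policy X th $ a = exp (X $ a \<bullet> th) / (\<Sum>b\<in>UNIV. exp (X $ b \<bullet> th))"
  by (simp add: policy_def softmax_def matrix_vector_mul_component)

lemma policy_pos: "policy X th $ a > 0"
  by (simp add: policy_nth sum_pos)

lemma policy_sum: "(\<Sum>a\<in>UNIV. policy X th $ a) = 1"
proof -
  have "(\<Sum>b\<in>UNIV. exp (X $ b \<bullet> th)) > 0" by (simp add: sum_pos)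
  then show ?thesis
    by (simp add: policy_nth flip: sum_divide_distrib)
qed

lemma policy_le_1: "policy X th $ a \<le> 1"
  using member_le_sum[of a UNIV "\<lambda>a. policy X th $ a"] policy_pos[of X th] policy_sum[of X th]
  by (simp add: less_imp_le)

text \<open>The normalising sums cancel. With \<open>b\<close> the optimal action, the exponent is
  the negated logit gap of \<open>a\<close>.\<close>

lemma policy_ratio:
  "policy X th $ a = policy X th $ b * exp (- ((X $ b - X $ a) \<bullet> th))"
  by (simp add: policy_nth inner_diff_left exp_diff)

text \<open>The importance weight cancels, so no division by a small probability remains.\<close>

lemma gradient_estimate:
  fixes X :: "real ^ 'd ^ ('k::finite)"
  assumes "q $ b \<noteq> 0"
  shows "transpose X *v ((diag_mat q - outer_prod q q) *v reward_estimate q b x)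
    = x *\<^sub>R (X $ b - (\<Sum>c\<in>UNIV. q $ c *\<^sub>R X $ c))"
proof -
  \<comment> \<open>The \<open>q\<close>-mean of the estimate is the observed reward itself, so
    subtracting it shifts every coordinate by the same \<open>x\<close> before weighting by
    \<open>q $ i\<close>.\<close>
  have est: "(\<Sum>j\<in>UNIV. q $ j * reward_estimate q b x $ j) = x"
  proof -
    have "(\<Sum>j\<in>UNIV. q $ j * reward_estimate q b x $ j) = (\<Sum>j\<in>UNIV. if j = b then x else 0)"
      using assms by (intro sum.cong) (auto simp: reward_estimate_def)
    then show ?thesis by simp
  qed
  have H: "((diag_mat q - outer_prod q q) *v reward_estimate q b x) $ i
      = x * ((if i = b then 1 else 0) - q $ i)" for i
  proof -
    have "((diag_mat q - outer_prod q q) *v reward_estimate q b x) $ i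
      = (\<Sum>j\<in>UNIV. (if i = j then q $ i * reward_estimate q b x $ j else 0)
           - q $ i * (q $ j * reward_estimate q b x $ j))"
      by (auto simp: matrix_vector_mult_def diag_mat_def outer_prod_def algebra_simps
          intro!: sum.cong)
    also have "\<dots> = q $ i * reward_estimate q b x $ i - q $ i * x"
      by (simp add: sum_subtractf est flip: sum_distrib_left)
    also have "\<dots> = x * ((if i = b then 1 else 0) - q $ i)"
      using assms by (auto simp: reward_estimate_def algebra_simps)
    finally show ?thesis .
  qed
  have T: "transpose X *v v = (\<Sum>i\<in>UNIV. v $ i *\<^sub>R X $ i)" for v
    by (simp add: vec_eq_iff matrix_vector_mult_def transpose_def mult.commute)
  have "transpose X *v ((diag_mat q - outer_prod q q) *v reward_estimate q b x)
    = (\<Sum>i\<in>UNIV. x *\<^sub>R ((if i = b then X $ i else 0) - q $ i *\<^sub>R X $ i))"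
    unfolding T H by (auto simp: algebra_simps intro!: sum.cong)
  also have "\<dots> = x *\<^sub>R (X $ b - (\<Sum>c\<in>UNIV. q $ c *\<^sub>R X $ c))"
    by (simp add: sum_subtractf flip: scaleR_sum_right)
  finally show ?thesis .
qed

section \<open>Drift against variance\<close>

text \<open>For weights of total mass \<open>1\<close> this is a covariance, with only
  \<open>g\<close> centred. In this form it is the expected update: mean reward of the sampled
  action times its centred feature value.\<close>

definition wcov :: "('k::finite \<Rightarrow> real) \<Rightarrow> ('k \<Rightarrow> real) \<Rightarrow> ('k \<Rightarrow> real) \<Rightarrow> real" where
  "wcov q f g = (\<Sum>a\<in>UNIV. q a * f a * (g a - (\<Sum>b\<in>UNIV. q b * g b)))"

definition wvar :: "('k::finite \<Rightarrow> real) \<Rightarrow> ('k \<Rightarrow> real) \<Rightarrow> real" where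
  "wvar q g = (\<Sum>a\<in>UNIV. q a * (g a - (\<Sum>b\<in>UNIV. q b * g b))\<^sup>2)"

text \<open>Expanding the product, every double sum factors into single sums. In the pairwise form
  the sign of each term is governed by how the two actions are ordered by \<open>f\<close> and by
  \<open>g\<close>.\<close>

lemma wcov_pairs:
  fixes q f g :: "'k::finite \<Rightarrow> real"
  assumes "(\<Sum>a\<in>UNIV. q a) = 1"
  shows "wcov q f g
    = (\<Sum>a\<in>UNIV. \<Sum>b\<in>UNIV. q a * q b * ((f a - f b) * (g a - g b))) / 2"
proof -
  let ?S = "\<lambda>h. \<Sum>a\<in>UNIV. q a * h a"
  have prod: "(\<Sum>a\<in>UNIV. \<Sum>b\<in>UNIV. (q a * h a) * (q b * k b)) = ?S h * ?S k" for h k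
    by (simp add: sum_product)
  have "(\<Sum>a\<in>UNIV. \<Sum>b\<in>UNIV. q a * q b * ((f a - f b) * (g a - g b)))
     = (\<Sum>a\<in>UNIV. \<Sum>b\<in>UNIV. (q a * (f a * g a)) * (q b * 1) - (q a * f a) * (q b * g b)
        - (q a * g a) * (q b * f b) + (q a * 1) * (q b * (f b * g b)))"
    by (intro sum.cong refl) (simp add: algebra_simps)
  also have "\<dots> = 2 * (?S (\<lambda>a. f a * g a) - ?S f * ?S g)"
    unfolding sum.distrib sum_subtractf prod using assms by simp
  finally have "(\<Sum>a\<in>UNIV. \<Sum>b\<in>UNIV. q a * q b * ((f a - f b) * (g a - g b))) / 2
     = ?S (\<lambda>a. f a * g a) - ?S f * ?S g" by simp
  moreover have "(\<Sum>a\<in>UNIV. q a * f a * (g a - ?S g)) = ?S (\<lambda>a. f a * g a) - ?S f * ?S g"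
    by (simp add: right_diff_distrib sum_subtractf sum_distrib_right mult.assoc)
  ultimately show ?thesis by (simp add: wcov_def)
qed

lemma wvar_pairs:
  fixes q g :: "'k::finite \<Rightarrow> real"
  assumes "(\<Sum>a\<in>UNIV. q a) = 1"
  shows "wvar q g
    = (\<Sum>a\<in>UNIV. \<Sum>b\<in>UNIV. q a * q b * (g a - g b)\<^sup>2) / 2"
proof -
  let ?m = "\<Sum>b\<in>UNIV. q b * g b"
  have "wvar q g
     = (\<Sum>a\<in>UNIV. q a * g a * (g a - ?m)) - ?m * (\<Sum>a\<in>UNIV. q a * g a - q a * ?m)"
    by (simp add: wvar_def power2_eq_square algebra_simps sum_subtractf sum.distrib sum_distrib_left)
  also have "(\<Sum>a\<in>UNIV. q a * g a - q a * ?m) = 0"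
    using assms by (simp add: sum_subtractf flip: sum_distrib_right)
  finally show ?thesis
    using wcov_pairs[OF assms, of g g] by (simp add: wcov_def power2_eq_square)
qed

text \<open>The deviation from the mean is the \<open>q\<close>-average of the differences
  \<open>g a - g b\<close>.\<close>

lemma weighted_mean_dist:
  fixes q g :: "'k::finite \<Rightarrow> real"
  assumes "\<And>b. q b \<ge> 0" "(\<Sum>b\<in>UNIV. q b) = 1" and "\<And>b. \<bar>g a - g b\<bar> \<le> G"
  shows "\<bar>g a - (\<Sum>b\<in>UNIV. q b * g b)\<bar> \<le> G"
proof -
  have "g a - (\<Sum>b\<in>UNIV. q b * g b) = (\<Sum>b\<in>UNIV. q b * (g a - g b))"
    using assms by (simp add: right_diff_distrib sum_subtractf flip: sum_distrib_right)
  also have "\<bar>\<dots>\<bar> \<le> (\<Sum>b\<in>UNIV. q b * G)"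
    using assms by (intro order_trans[OF sum_abs] sum_mono) (simp add: abs_mult mult_left_mono)
  finally show ?thesis using assms by (simp flip: sum_distrib_right)
qed

lemma wcov_le:
  fixes q f g :: "'k::finite \<Rightarrow> real"
  assumes "\<And>b. q b \<ge> 0" "(\<Sum>b\<in>UNIV. q b) = 1" and "\<And>a b. \<bar>g a - g b\<bar> \<le> G"
  shows "wcov q f g \<le> (\<Sum>a\<in>UNIV. \<bar>f a\<bar>) * G"
  unfolding wcov_def sum_distrib_right
proof (rule sum_mono)
  fix a
  have "q a \<le> 1" using member_le_sum[of a UNIV q] assms by simp
  have "q a * f a * (g a - (\<Sum>b\<in>UNIV. q b * g b)) \<le> \<bar>q a * f a * (g a - (\<Sum>b\<in>UNIV. q b * g b))\<bar>"
    by (rule abs_ge_self)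
  also have "\<dots> \<le> 1 * \<bar>f a\<bar> * G"
    unfolding abs_mult
    using assms \<open>q a \<le> 1\<close> weighted_mean_dist[OF assms] by (intro mult_mono) auto
  finally show "q a * f a * (g a - (\<Sum>b\<in>UNIV. q b * g b)) \<le> \<bar>f a\<bar> * G" by simp
qed

lemma wvar_nonneg: "(\<And>b. q b \<ge> 0) \<Longrightarrow> wvar q g \<ge> 0"
  unfolding wvar_def by (intro sum_nonneg mult_nonneg_nonneg) auto

text \<open>Pairs whose better action beats \<open>j\<close> push \<open>g\<close> upwards, with a drift that dominates
  their own variance. A pair without such an action contains a member worse than \<open>j\<close>, whence
  the negative term.\<close>

lemma drift_minus_variance_ge:
  fixes r g :: "'k::finite \<Rightarrow> real"
  assumes inj: "inj r"
    and best: "\<And>b. b \<noteq> star \<Longrightarrow> r b < r star"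
    and strict: "\<And>b. b \<noteq> star \<Longrightarrow> g b < g star"
    and weak: "\<And>a b. r a > r b \<Longrightarrow> r a > r j \<Longrightarrow> g a \<ge> g b"
    and j: "j \<noteq> star"
  shows "\<exists>l0>0. \<exists>c>0. \<exists>C\<ge>0. \<forall>l q. 0 < l \<longrightarrow> l \<le> l0 \<longrightarrow> (\<forall>a. q a \<ge> 0) \<longrightarrow> sum q UNIV = 1 \<longrightarrow>
    (1 - q star) * (c * q star - C * (\<Sum>b | r b < r j. q b))
    \<le> wcov q r g - l * wvar q g"
proof -
  obtain B where B: "B > 0" "\<And>a b. \<bar>g a - g b\<bar> \<le> B"
    using finite_ex_diff_bound[of g] by blast
  obtain E where E: "E > 0" "\<And>a b. \<bar>r a - r b\<bar> \<le> E"
    using finite_ex_diff_bound[of r] by blast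
  have "\<exists>d>0. \<forall>x\<in>{(a, b). r a > r b}. d \<le> (\<lambda>(a, b). r a - r b) x"
    by (rule finite_ex_pos_lower_bound) auto
  then obtain d where d: "d > 0" "\<And>a b. r a > r b \<Longrightarrow> d \<le> r a - r b" by auto
  have "\<exists>e>0. \<forall>x\<in>{b. b \<noteq> star}. e \<le> g star - g x"
    by (rule finite_ex_pos_lower_bound) (auto simp: strict)
  then obtain e where e: "e > 0" "\<And>b. b \<noteq> star \<Longrightarrow> e \<le> g star - g b" by auto
  \<comment> \<open>Here \<open>d\<close> bounds the positive reward differences from below and
    \<open>e\<close> the advantage of \<open>star\<close> in \<open>g\<close>. The choice of
    \<open>l0\<close> lets the variance of a good pair consume at most half of its drift;
    \<open>c\<close> is what then remains for a pair containing \<open>star\<close>, and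
    \<open>C\<close> bounds the loss of an arbitrary pair.\<close>
  define l0 where "l0 = d / (2 * B)"
  define c where "c = d * e / 2"
  define C where "C = E * B + l0 * B\<^sup>2"
  have l0: "l0 > 0" using d B by (simp add: l0_def)
  have c: "c > 0" using d e by (simp add: c_def)
  have C: "C \<ge> 0" using E B l0 by (simp add: C_def)
  have main: "(1 - q star) * (c * q star - C * (\<Sum>b | r b < r j. q b))
    \<le> wcov q r g - l * wvar q g"
    if l: "0 < l" "l \<le> l0" and q: "\<And>a. q a \<ge> 0" "sum q UNIV = 1" for l q
  proof -
    \<comment> \<open>\<open>h a b\<close> is the net contribution of a pair. The indicators
      \<open>s\<close>, \<open>n\<close>, \<open>w\<close> mark \<open>star\<close>, the other
      actions, and the actions worse than \<open>j\<close>, so that the pairwise lower bounds sum to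
      products of single sums.\<close>
    define h where "h a b = (r a - r b) * (g a - g b) - l * (g a - g b)\<^sup>2" for a b
    define s where "s a = (if a = star then 1 else 0 :: real)" for a
    define n where "n a = (if a = star then 0 else 1 :: real)" for a
    define w where "w a = (if r a < r j then 1 else 0 :: real)" for a
    have wn: "w a \<ge> 0" "n a \<ge> 0" for a by (auto simp: w_def n_def)
    have good: "h a b \<ge> (d / 2) * (g a - g b)" "g a \<ge> g b" if "r a > r b" "r a > r j" for a b
    proof -
      show ab: "g a \<ge> g b" using weak that by blast
      have "l * (g a - g b) \<le> l0 * B"
        using l B(2)[of a b] ab B(1) by (intro mult_mono) auto
      also have "\<dots> = d / 2" using B by (simp add: l0_def)
      finally have "l * (g a - g b) * (g a - g b) \<le> d / 2 * (g a - g b)"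
        using ab by (intro mult_right_mono) auto
      moreover have "d * (g a - g b) \<le> (r a - r b) * (g a - g b)"
        using d that ab by (intro mult_right_mono) auto
      ultimately show "h a b \<ge> (d / 2) * (g a - g b)"
        by (simp add: h_def power2_eq_square)
    qed
    have bad: "h a b \<ge> - C" for a b
    proof -
      have "\<bar>(r a - r b) * (g a - g b)\<bar> \<le> E * B"
        unfolding abs_mult using E B by (intro mult_mono) auto
      moreover have "l * (g a - g b)\<^sup>2 \<le> l0 * B\<^sup>2"
        using l B(2)[of a b] B(1) by (intro mult_mono) (auto simp: abs_le_square_iff[symmetric])
      ultimately show ?thesis by (simp add: h_def C_def)
    qed
    \<comment> \<open>The better action comes first. If it does not beat \<open>j\<close>, it
      differs from \<open>star\<close> and its partner is worse than \<open>j\<close>, so the term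
      with \<open>C\<close> absorbs the whole loss.\<close>
    have half: "h a b \<ge> c * (s a * n b) - C * (w b * n a)" if "r a > r b" for a b
    proof (cases "r a > r j")
      case True
      have "c * (s a * n b) \<le> (d / 2) * (g a - g b)"
      proof (cases "a = star \<and> b \<noteq> star")
        case True
        then have "e \<le> g a - g b" using e by auto
        then show ?thesis using True d by (auto simp: s_def n_def c_def)
      next
        case False
        then show ?thesis using good(2)[OF that \<open>r a > r j\<close>] d by (auto simp: s_def n_def)
      qed
      moreover have "C * (w b * n a) \<ge> 0" using C wn by simp
      ultimately show ?thesis using good(1)[OF that True] by linarith
    next
      case False
      have "a \<noteq> star" using False best[OF j] by auto
      moreover have "r b < r j" using False that by simp
      ultimately show ?thesis using bad[of a b] by (simp add: s_def n_def w_def)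
    qed
    have sym: "h a b = h b a" for a b by (simp add: h_def power2_eq_square algebra_simps)
    \<comment> \<open>For unordered actions, symmetry of \<open>h\<close> reduces to the previous
      case and the extra terms have the right sign. On the diagonal \<open>h\<close> vanishes, and
      so does \<open>s a * n a\<close>.\<close>
    have pair: "h a b \<ge> c * (s a * n b + n a * s b) - C * (w b * n a + n b * w a)" for a b
    proof -
      consider "r a > r b" | "r b > r a" | "a = b" using inj by (metis injD linorder_neqE_linordered_idom)
      then show ?thesis
      proof cases
        case 1
        have "c * (n a * s b) = 0" using 1 best[of a] by (auto simp: s_def n_def)
        moreover have "C * (n b * w a) \<ge> 0" using C wn by simp
        ultimately show ?thesis using half[OF 1] unfolding distrib_left by linarith
      next
        case 2
        have "c * (n b * s a) = 0" using 2 best[of b] by (auto simp: s_def n_def)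
        moreover have "C * (n a * w b) \<ge> 0" using C wn by simp
        ultimately show ?thesis using half[OF 2] sym[of a b]
          unfolding distrib_left by (simp only: mult.commute)
      next
        case 3
        have "C * (w a * n a) \<ge> 0" using C wn by simp
        then show ?thesis using 3 by (auto simp: s_def n_def h_def mult.commute)
      qed
    qed
    have S: "(\<Sum>a\<in>UNIV. q a * s a) = q star"
      by (simp add: s_def if_distrib cong: if_cong)
    have N: "(\<Sum>a\<in>UNIV. q a * n a) = 1 - q star"
    proof -
      have "(\<Sum>a\<in>UNIV. q a * n a) = (\<Sum>a\<in>UNIV. q a - q a * s a)"
        by (intro sum.cong) (auto simp: s_def n_def)
      then show ?thesis by (simp add: sum_subtractf S q)
    qed
    have W: "(\<Sum>a\<in>UNIV. q a * w a) = (\<Sum>b | r b < r j. q b)"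
      by (simp add: w_def sum.If_cases if_distrib cong: if_cong)
    \<comment> \<open>The factor \<open>2\<close> arises because every pair occurs in both orders,
      as in the pairwise formulas for \<open>wcov\<close> and \<open>wvar\<close>.\<close>
    have "2 * ((1 - q star) * (c * q star - C * (\<Sum>b | r b < r j. q b)))
      = c * (q star * (1 - q star) + (1 - q star) * q star)
        - C * ((1 - q star) * (\<Sum>b | r b < r j. q b) + (\<Sum>b | r b < r j. q b) * (1 - q star))"
      by (simp add: algebra_simps)
    also have "\<dots> = (\<Sum>a\<in>UNIV. \<Sum>b\<in>UNIV. c * (q a * s a * (q b * n b) + q a * n a * (q b * s b))
        - C * (q a * n a * (q b * w b) + q a * w a * (q b * n b)))"
      by (simp only: sum_subtractf sum.distrib sum_distrib_left[symmetric] sum_distrib_right[symmetric] S N W)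
    also have "\<dots> \<le> (\<Sum>a\<in>UNIV. \<Sum>b\<in>UNIV. q a * q b * h a b)"
    proof (intro sum_mono)
      fix a b
      have "q a * q b * (c * (s a * n b + n a * s b) - C * (w b * n a + n b * w a)) \<le> q a * q b * h a b"
        using q pair by (intro mult_left_mono) auto
      then show "c * (q a * s a * (q b * n b) + q a * n a * (q b * s b))
        - C * (q a * n a * (q b * w b) + q a * w a * (q b * n b)) \<le> q a * q b * h a b"
        by (simp add: algebra_simps)
    qed
    also have "\<dots> = (\<Sum>a\<in>UNIV. \<Sum>b\<in>UNIV. q a * q b * ((r a - r b) * (g a - g b)))
        - l * (\<Sum>a\<in>UNIV. \<Sum>b\<in>UNIV. q a * q b * (g a - g b)\<^sup>2)"
      unfolding h_def sum_distrib_left sum_subtractf[symmetric]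
      by (intro sum.cong refl) (simp add: algebra_simps)
    also have "\<dots> = 2 * (wcov q r g - l * wvar q g)"
    proof -
      have "x - l * y = 2 * (x / 2 - l * (y / 2))" for x y :: real by (simp add: field_simps)
      then show ?thesis unfolding wcov_pairs[OF q(2)] wvar_pairs[OF q(2)] .
    qed
    finally show ?thesis by simp
  qed
  show ?thesis using l0 c C main by blast
qed

section \<open>Convergence of a single trajectory\<close>

text \<open>This is purely deterministic. The negative term in \<open>growth\<close> involves only
  actions worse than \<open>j\<close>, so it is harmless once these are controlled relative to
  \<open>star\<close>; what control means depends on whether the positive drift is summable.\<close>

lemma trajectory_convergence:
  fixes q Y :: "nat \<Rightarrow> 'k::finite \<Rightarrow> real"
  assumes pos: "\<And>n a. q n a > 0" and sum1: "\<And>n. (\<Sum>a\<in>UNIV. q n a) = 1"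
    and ratio: "\<And>n a. q n a = q n star * exp (- Y n a)"
    and best: "\<And>b. b \<noteq> star \<Longrightarrow> r b < (r star :: real)"
    and growth: "\<And>j. j \<noteq> star \<Longrightarrow> \<exists>L. \<exists>c>0. \<exists>C\<ge>0. \<forall>n.
      Y n j \<ge> - L + (\<Sum>s<n. (1 - q s star) * (c * q s star - C * (\<Sum>b | r b < r j. q s b)))"
  shows "(\<lambda>n. q n star) \<longlonglongrightarrow> 1"
proof -
  have le1: "q n star \<le> 1" for n
    using member_le_sum[of star UNIV "q n"] pos sum1 by (simp add: less_imp_le)
  define f where "f n = (1 - q n star) * q n star" for n
  have f0: "f n \<ge> 0" for n using le1 pos[of n star] by (simp add: f_def)
  \<comment> \<open>Induction on the number of strictly worse actions; for a worst action the
    hypothesis is vacuous.\<close>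
  have rind: "P j" if "\<And>j. (\<And>b. r b < r j \<Longrightarrow> P b) \<Longrightarrow> P j" for P and j :: 'k
  proof (induction "card {b. r b < r j}" arbitrary: j rule: less_induct)
    case less
    show ?case
    proof (rule that)
      fix b assume "r b < r j"
      then have "{l. r l < r b} \<subset> {l. r l < r j}" by auto
      then show "P b" by (intro less psubset_card_mono) auto
    qed
  qed
  show ?thesis
  proof (cases "summable f")
    case True
    \<comment> \<open>In the summable case the invariant is domination by a constant multiple of
      \<open>q n star\<close>. It makes each negative term at least \<open>- (F * f s)\<close>,
      whose sum is bounded, so the gap \<open>Y n j\<close> is bounded below and the domination
      passes to \<open>j\<close>.\<close>
    have bdd: "j \<noteq> star \<longrightarrow> (\<exists>E\<ge>0. \<forall>n. q n j \<le> E * q n star)" for j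
    proof (induct j rule: rind, intro impI)
      fix j assume IH: "\<And>b. r b < r j \<Longrightarrow> b \<noteq> star \<longrightarrow> (\<exists>E\<ge>0. \<forall>n. q n b \<le> E * q n star)"
        and j: "j \<noteq> star"
      have "\<exists>E\<ge>0. \<forall>n. q n b \<le> E * q n star" if "r b < r j" for b
        using IH[OF that] best[OF j] that by auto
      then obtain E where E: "\<And>b. r b < r j \<Longrightarrow> E b \<ge> 0"
        "\<And>b n. r b < r j \<Longrightarrow> q n b \<le> E b * q n star" by metis
      obtain L c C where g: "c > 0" "C \<ge> 0"
        "\<And>n. Y n j \<ge> - L + (\<Sum>s<n. (1 - q s star) * (c * q s star - C * (\<Sum>b | r b < r j. q s b)))"
        using growth[OF j] by blast
      define F where "F = C * (\<Sum>b | r b < r j. E b)"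
      have F: "F \<ge> 0" using g E by (auto simp: F_def intro!: sum_nonneg mult_nonneg_nonneg)
      have "Y n j \<ge> - (L + F * suminf f)" for n
      proof -
        have "(1 - q s star) * (c * q s star - C * (\<Sum>b | r b < r j. q s b)) \<ge> - (F * f s)" for s
        proof -
          have "(\<Sum>b | r b < r j. q s b) \<le> (\<Sum>b | r b < r j. E b * q s star)"
            using E by (intro sum_mono) auto
          then have "C * (\<Sum>b | r b < r j. q s b) \<le> F * q s star"
            using g(2) unfolding F_def
            by (simp add: mult.assoc mult_left_mono flip: sum_distrib_right)
          moreover have "c * q s star \<ge> 0" using g pos[of s star] by simp
          ultimately have "c * q s star - C * (\<Sum>b | r b < r j. q s b) \<ge> - (F * q s star)" by linarith
          then have "(1 - q s star) * (c * q s star - C * (\<Sum>b | r b < r j. q s b))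
              \<ge> (1 - q s star) * - (F * q s star)"
            using le1 by (intro mult_left_mono) auto
          then show ?thesis by (simp add: f_def mult_ac)
        qed
        then have "(\<Sum>s<n. (1 - q s star) * (c * q s star - C * (\<Sum>b | r b < r j. q s b)))
            \<ge> (\<Sum>s<n. - (F * f s))"
          by (intro sum_mono)
        moreover have "(\<Sum>s<n. F * f s) \<le> F * suminf f"
          unfolding sum_distrib_left[symmetric]
          using F f0 True by (intro mult_left_mono sum_le_suminf) auto
        ultimately show ?thesis using g(3)[of n] by (simp add: sum_negf)
      qed
      then have "exp (- Y n j) \<le> exp (L + F * suminf f)" for n
        by (metis add.inverse_inverse exp_le_cancel_iff neg_le_iff_le)
      then have "q n j \<le> exp (L + F * suminf f) * q n star" for n
        using ratio[of n j] pos[of n star] by (simp add: mult.commute mult_right_mono)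
      then show "\<exists>E\<ge>0. \<forall>n. q n j \<le> E * q n star" by (meson exp_ge_zero)
    qed
    have "\<exists>E\<ge>0. \<forall>n. q n j \<le> E * q n star" for j
      using bdd[of j] by (cases "j = star") (auto intro: exI[of _ 1])
    then obtain E where E: "\<And>b. E b \<ge> 0" "\<And>b n. q n b \<le> E b * q n star" by metis
    \<comment> \<open>Summing the dominations over all actions keeps \<open>q n star\<close> away
      from \<open>0\<close>. Multiplied by \<open>1 - q n star\<close>, this bounds the latter by a
      multiple of \<open>f n\<close>, which tends to \<open>0\<close>.\<close>
    have one: "1 \<le> (\<Sum>b\<in>UNIV. E b) * q n star" for n
      using sum_mono[of UNIV "q n" "\<lambda>b. E b * q n star"] E(2) sum1[of n]
      by (simp add: sum_distrib_right)
    have "(\<lambda>n. (\<Sum>b\<in>UNIV. E b) * f n) \<longlonglongrightarrow> (\<Sum>b\<in>UNIV. E b) * 0"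
      by (intro tendsto_intros summable_LIMSEQ_zero True)
    then have "(\<lambda>n. (\<Sum>b\<in>UNIV. E b) * f n) \<longlonglongrightarrow> 0" by simp
    then have "(\<lambda>n. 1 - q n star) \<longlonglongrightarrow> 0"
    proof (rule tendsto_sandwich[rotated 3])
      have "1 - q n star \<le> (\<Sum>b\<in>UNIV. E b) * f n" for n
        using mult_left_mono[OF one[of n], of "1 - q n star"] le1 by (simp add: f_def mult_ac)
      then show "\<forall>\<^sub>F n in sequentially. 1 - q n star \<le> (\<Sum>b\<in>UNIV. E b) * f n" by simp
    qed (use le1 in auto)
    from tendsto_diff[OF tendsto_const[of 1] this] show ?thesis by simp
  next
    case False
    have ftop: "filterlim (\<lambda>n. \<Sum>s<n. f s) at_top sequentially"
    proof -
      have "\<exists>N. \<forall>n\<ge>N. Z \<le> (\<Sum>s<n. f s)" for Z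
      proof -
        obtain N where N: "Z < (\<Sum>s<N. f s)"
          using False summableI_nonneg_bounded[of f Z] f0 by (meson not_le)
        have "(\<Sum>s<N. f s) \<le> (\<Sum>s<n. f s)" if "n \<ge> N" for n
          using f0 that by (intro sum_mono2) auto
        then show ?thesis using N by (meson less_imp_le order_trans)
      qed
      then show ?thesis unfolding filterlim_at_top eventually_sequentially by blast
    qed
    \<comment> \<open>In the divergent case the invariant is that the gap tends to infinity, that
      is, the probability relative to \<open>star\<close> vanishes.\<close>
    have top: "j \<noteq> star \<longrightarrow> ((\<lambda>n. exp (- Y n j)) \<longlonglongrightarrow> 0)" for j
    proof (induct j rule: rind, intro impI)
      fix j assume IH: "\<And>b. r b < r j \<Longrightarrow> b \<noteq> star \<longrightarrow> ((\<lambda>n. exp (- Y n b)) \<longlonglongrightarrow> 0)"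
        and j: "j \<noteq> star"
      have IH': "(\<lambda>n. exp (- Y n b)) \<longlonglongrightarrow> 0" if "r b < r j" for b
        using IH[OF that] best[OF j] that by auto
      obtain L c C where g: "c > 0" "C \<ge> 0"
        "\<And>n. Y n j \<ge> - L + (\<Sum>s<n. (1 - q s star) * (c * q s star - C * (\<Sum>b | r b < r j. q s b)))"
        using growth[OF j] by blast
      define t where "t s = (1 - q s star) * (c * q s star - C * (\<Sum>b | r b < r j. q s b))" for s
      have "(\<lambda>n. C * (\<Sum>b | r b < r j. exp (- Y n b))) \<longlonglongrightarrow> C * (\<Sum>b | r b < r j. 0)"
        by (intro tendsto_intros IH') auto
      then have "(\<lambda>n. C * (\<Sum>b | r b < r j. exp (- Y n b))) \<longlonglongrightarrow> 0" by simp
      then have "\<forall>\<^sub>F n in sequentially. C * (\<Sum>b | r b < r j. exp (- Y n b)) < c / 2"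
        using g(1) by (intro order_tendstoD) auto
      \<comment> \<open>From \<open>N\<close> on, the worse actions cancel at most half of the
        positive drift.\<close>
      then obtain N where N: "\<And>n. n \<ge> N \<Longrightarrow> C * (\<Sum>b | r b < r j. exp (- Y n b)) < c / 2"
        by (auto simp: eventually_sequentially)
      have tN: "t s \<ge> c / 2 * f s" if "s \<ge> N" for s
      proof -
        have "C * (\<Sum>b | r b < r j. q s b) = q s star * (C * (\<Sum>b | r b < r j. exp (- Y s b)))"
          by (subst ratio) (simp add: sum_distrib_left mult_ac)
        also have "\<dots> \<le> q s star * (c / 2)"
          using N[OF that] pos[of s star] by (intro mult_left_mono) auto
        finally have "c * q s star - C * (\<Sum>b | r b < r j. q s b) \<ge> c / 2 * q s star"
          by (simp add: algebra_simps)
        then have "t s \<ge> (1 - q s star) * (c / 2 * q s star)"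
          unfolding t_def using le1 by (intro mult_left_mono) auto
        then show ?thesis by (simp add: f_def mult_ac)
      qed
      \<comment> \<open>\<open>D\<close> is the balance of the finitely many rounds before
        \<open>N\<close>, where \<open>t s\<close> may fall below
        \<open>c / 2 * f s\<close>.\<close>
      define D where "D = (\<Sum>s<N. t s - c / 2 * f s)"
      have lower: "- L + D + c / 2 * (\<Sum>s<n. f s) \<le> Y n j" if "n \<ge> N" for n
      proof -
        have "D \<le> (\<Sum>s<n. t s - c / 2 * f s)"
          unfolding D_def using that tN by (intro sum_mono2) auto
        then show ?thesis using g(3)[of n]
          by (simp add: sum_subtractf sum_distrib_left t_def)
      qed
      have "filterlim (\<lambda>n. - L + D + c / 2 * (\<Sum>s<n. f s)) at_top sequentially"
        by (intro filterlim_tendsto_add_at_top[OF tendsto_const]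
            filterlim_tendsto_pos_mult_at_top[OF tendsto_const _ ftop]) (use g in auto)
      then have "filterlim (\<lambda>n. Y n j) at_top sequentially"
        by (rule filterlim_at_top_mono) (rule eventually_sequentiallyI[of N], rule lower)
      then show "(\<lambda>n. exp (- Y n j)) \<longlonglongrightarrow> 0"
        by (intro filterlim_compose[OF exp_at_bot]) (simp add: filterlim_uminus_at_bot)
    qed
    have Y0: "exp (- Y n star) = 1" for n using ratio[of n star] pos[of n star] by simp
    \<comment> \<open>Total mass \<open>1\<close> and the ratios determine \<open>q n star\<close>
      from the gaps alone, so its limit can be read off.\<close>
    have inv: "q n star = 1 / (1 + (\<Sum>b\<in>-{star}. exp (- Y n b)))" for n
    proof -
      have "1 = (\<Sum>b\<in>UNIV. q n star * exp (- Y n b))" using sum1[of n] by (simp flip: ratio)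
      also have "\<dots> = q n star * (\<Sum>b\<in>insert star (-{star}). exp (- Y n b))"
        by (simp add: sum_distrib_left insert_UNIV[symmetric] Compl_eq_Diff_UNIV)
      also have "\<dots> = q n star * (1 + (\<Sum>b\<in>-{star}. exp (- Y n b)))"
        by (subst sum.insert) (auto simp: Y0)
      finally show ?thesis
        by (metis mult_zero_right nonzero_eq_divide_eq zero_neq_one)
    qed
    have "(\<lambda>n. 1 / (1 + (\<Sum>b\<in>-{star}. exp (- Y n b)))) \<longlonglongrightarrow> 1 / (1 + (\<Sum>b\<in>-{star}. 0))"
      using top by (intro tendsto_intros) auto
    then show ?thesis by (simp flip: inv)
  qed
qed

section \<open>Supermartingales\<close>

text \<open>Ville's maximal inequality gives \<open>a * P(W reaches a) \<le> E W\<^sub>0\<close>; the potential in the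
  proof adds \<open>a\<close> on the event that the level has been reached.\<close>

lemma (in prob_space) nonneg_supermartingale_bounded:
  fixes W :: "nat \<Rightarrow> 'a \<Rightarrow> real"
  assumes int: "\<And>n. integrable M (W n)"
    and nonneg: "\<And>n w. 0 \<le> W n w"
    and step: "\<And>n a. (\<integral>w. W (Suc n) w * indicator {w \<in> space M. \<forall>s\<le>n. W s w < a} w \<partial>M)
      \<le> (\<integral>w. W n w * indicator {w \<in> space M. \<forall>s\<le>n. W s w < a} w \<partial>M)"
  shows "AE w in M. \<exists>B. \<forall>n. W n w \<le> B"
proof -
  have meas[measurable]: "W n \<in> borel_measurable M" for n using int by (rule borel_measurable_integrable)
  define N where "N a n = {w \<in> space M. \<forall>s\<le>n. W s w < a}" for a n
  have N[measurable]: "N a n \<in> sets M" for a n unfolding N_def by measurable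
  define E where "E = (\<integral>w. W 0 w \<partial>M)"
  have intN: "integrable M (\<lambda>w. W m w * indicator (N a n) w)" for m a n
    using integrable_mult_indicator[OF N int, of a n m] by (simp add: mult.commute)
  have intC: "integrable M (\<lambda>w. a * indicator (space M - N a n) w :: real)" for a n
    by (intro integrable_mult_right integrable_real_indicator) (simp_all add: emeasure_eq_measure)
  have pot: "(\<integral>w. a * indicator (space M - N a n) w \<partial>M) + (\<integral>w. W n w * indicator (N a n) w \<partial>M) \<le> E"
    if a: "a > 0" for a n
  proof (induction n)
    case 0
    have "(\<integral>w. a * indicator (space M - N a 0) w \<partial>M) + (\<integral>w. W 0 w * indicator (N a 0) w \<partial>M)
       = (\<integral>w. a * indicator (space M - N a 0) w + W 0 w * indicator (N a 0) w \<partial>M)"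
      by (rule Bochner_Integration.integral_add[symmetric]) (rule intC intN)+
    also have "\<dots> \<le> E" unfolding E_def
      by (intro integral_mono Bochner_Integration.integrable_add intC intN int)
        (auto simp: N_def indicator_def not_less)
    finally show ?case .
  next
    case (Suc n)
    have NS: "w \<in> N a (Suc n) \<longleftrightarrow> w \<in> N a n \<and> W (Suc n) w < a" for w
      by (simp add: N_def le_Suc_eq) blast
    have "(\<integral>w. a * indicator (space M - N a (Suc n)) w \<partial>M) + (\<integral>w. W (Suc n) w * indicator (N a (Suc n)) w \<partial>M)
       = (\<integral>w. a * indicator (space M - N a (Suc n)) w + W (Suc n) w * indicator (N a (Suc n)) w \<partial>M)"
      by (rule Bochner_Integration.integral_add[symmetric]) (rule intC intN)+
    also have "\<dots> \<le> (\<integral>w. a * indicator (space M - N a n) w + W (Suc n) w * indicator (N a n) w \<partial>M)"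
    proof (intro integral_mono Bochner_Integration.integrable_add intC intN)
      \<comment> \<open>A path that leaves \<open>N a\<close> in this step has
        \<open>W (Suc n) w \<ge> a\<close>, so exchanging its value for \<open>a\<close> only lowers
        the potential.\<close>
      fix w assume "w \<in> space M"
      then show "a * indicator (space M - N a (Suc n)) w + W (Suc n) w * indicator (N a (Suc n)) w
          \<le> a * indicator (space M - N a n) w + W (Suc n) w * indicator (N a n) w"
        by (cases "w \<in> N a n"; cases "W (Suc n) w < a") (simp_all add: NS indicator_def)
    qed
    also have "\<dots> = (\<integral>w. a * indicator (space M - N a n) w \<partial>M) + (\<integral>w. W (Suc n) w * indicator (N a n) w \<partial>M)"
      by (rule Bochner_Integration.integral_add) (rule intC intN)+
    also have "\<dots> \<le> E" using Suc step[of n a] unfolding N_def by linarith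
    finally show ?case .
  qed
  have prob_N: "prob (space M - N a n) \<le> E / a" if a: "a > 0" for a n
  proof -
    have "(\<integral>w. W n w * indicator (N a n) w \<partial>M) \<ge> 0"
      by (intro integral_nonneg_AE) (auto simp: nonneg)
    then have "a * prob (space M - N a n) \<le> E" using pot[OF a, of n] by simp
    then show ?thesis using a by (simp add: field_simps)
  qed
  \<comment> \<open>The event that level \<open>a\<close> is ever reached. Unbounded paths lie in
    \<open>Z\<close> for every level, and the bound \<open>E / a\<close> tends to \<open>0\<close>
    as the level grows.\<close>
  define Z where "Z a = (\<Union>n. space M - N a n)" for a
  have Z[measurable]: "Z a \<in> sets M" for a unfolding Z_def by measurable
  have prob_Z: "prob (Z a) \<le> E / a" if "a > 0" for a
  proof (rule LIMSEQ_le_const2)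
    show "(\<lambda>n. prob (space M - N a n)) \<longlonglongrightarrow> prob (Z a)"
      unfolding Z_def by (rule finite_Lim_measure_incseq) (auto simp: incseq_def N_def)
    show "\<exists>n0. \<forall>n\<ge>n0. prob (space M - N a n) \<le> E / a" using prob_N[OF that] by blast
  qed
  have "prob (\<Inter>k. Z (real (Suc k))) \<le> E / real (Suc k)" for k
  proof -
    have "prob (\<Inter>k. Z (real (Suc k))) \<le> prob (Z (real (Suc k)))"
      by (rule finite_measure_mono) auto
    also have "\<dots> \<le> E / real (Suc k)" by (rule prob_Z) simp
    finally show ?thesis .
  qed
  moreover have "(\<lambda>k. E / real (Suc k)) \<longlonglongrightarrow> 0"
    by (intro LIMSEQ_Suc[OF lim_const_over_n])
  ultimately have "prob (\<Inter>k. Z (real (Suc k))) \<le> 0"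
    by (intro LIMSEQ_le_const) auto
  then have "prob (\<Inter>k. Z (real (Suc k))) = 0" by (simp add: measure_le_0_iff)
  then have "(\<Inter>k. Z (real (Suc k))) \<in> null_sets M"
    by (simp add: emeasure_eq_measure null_sets_def)
  then have "AE w in M. w \<notin> (\<Inter>k. Z (real (Suc k)))" by (rule AE_not_in)
  then show ?thesis
  proof (rule AE_mp, intro AE_I2 impI)
    fix w assume w: "w \<in> space M" "w \<notin> (\<Inter>k. Z (real (Suc k)))"
    then obtain k where k: "\<And>n. w \<in> N (real (Suc k)) n" by (auto simp: Z_def)
    have "W n w \<le> real (Suc k)" for n using k[of n] by (simp add: N_def less_imp_le)
    then show "\<exists>B. \<forall>n. W n w \<le> B" by blast
  qed
qed

lemma integrable_mult_AE_bounded: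
  fixes U f :: "'a \<Rightarrow> real"
  assumes "integrable M U" "f \<in> borel_measurable M" "AE w in M. \<bar>f w\<bar> \<le> c"
  shows "integrable M (\<lambda>w. U w * f w)"
proof (rule Bochner_Integration.integrable_bound)
  show "integrable M (\<lambda>w. c * U w)" using assms by simp
  show "(\<lambda>w. U w * f w) \<in> borel_measurable M"
    using assms by (intro borel_measurable_times) auto
  show "AE w in M. norm (U w * f w) \<le> norm (c * U w)"
    using assms(3)
  proof eventually_elim
    case (elim w)
    then have "\<bar>U w\<bar> * \<bar>f w\<bar> \<le> \<bar>U w\<bar> * \<bar>c\<bar>" by (intro mult_left_mono) auto
    then show ?case by (simp add: abs_mult mult.commute)
  qed
qed

section \<open>Conditional laws along the policy gradient process\<close>

context softmax_pg
begin

text \<open>The form of the update used from here on: the feature of the sampled action, centred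
  under the current policy and scaled by the reward.\<close>

lemma theta_Suc:
  assumes "t \<ge> 1" "w \<in> space M"
  shows "theta (Suc t) w = theta t w + (eta * R t w) *\<^sub>R
    (X $ act t w - (\<Sum>c\<in>UNIV. policy X (theta t w) $ c *\<^sub>R X $ c))"
proof -
  have nz: "policy X (theta t w) $ act t w \<noteq> 0" using policy_pos[of X "theta t w" "act t w"] by simp
  then show ?thesis using theta_step[OF assms] by (simp only: gradient_estimate[OF nz] scaleR_scaleR)
qed

lemma history_measurable:
  "(\<lambda>w. \<lambda>s\<in>{1..<t}. (act s w, R s w)) \<in> measurable M (Pi\<^sub>M {1..<t} (\<lambda>_. count_space UNIV \<Otimes>\<^sub>M borel))"
  by (rule measurable_restrict) (auto intro!: measurable_Pair act_measurable R_measurable)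

lemma space_past [simp]: "space (past M act R t) = space M"
  by (simp add: past_def)

lemma space_past_action [simp]: "space (past_action M act R t) = space M"
  by (simp add: past_action_def)

lemma subalgebra_past: "subalgebra M (past M act R t)"
  unfolding subalgebra_def past_def
  by (intro conjI space_vimage_algebra sets_image_in_sets[OF refl history_measurable])

lemma subalgebra_past_action:
  assumes "t \<ge> 1"
  shows "subalgebra M (past_action M act R t)"
  unfolding subalgebra_def past_action_def
  by (intro conjI space_vimage_algebra sets_image_in_sets[OF refl measurable_Pair[OF history_measurable act_measurable[OF assms]]])

lemma history_measurable_past:
  "(\<lambda>w. \<lambda>s\<in>{1..<t}. (act s w, R s w))
    \<in> measurable (past M act R t) (Pi\<^sub>M {1..<t} (\<lambda>_. count_space UNIV \<Otimes>\<^sub>M borel))"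
  unfolding past_def
  using measurable_space[OF history_measurable] by (intro measurable_vimage_algebra1) auto

lemma past_coordinates:
  assumes "1 \<le> s" "s < t"
  shows "act s \<in> measurable (past M act R t) (count_space UNIV)"
    and "R s \<in> borel_measurable (past M act R t)"
proof -
  have "(\<lambda>w. (\<lambda>s\<in>{1..<t}. (act s w, R s w)) s)
      \<in> measurable (past M act R t) (count_space UNIV \<Otimes>\<^sub>M borel)"
    using assms by (intro measurable_compose[OF history_measurable_past measurable_component_singleton]) auto
  then have *: "(\<lambda>w. (act s w, R s w)) \<in> measurable (past M act R t) (count_space UNIV \<Otimes>\<^sub>M borel)"
    using assms by simp
  show "act s \<in> measurable (past M act R t) (count_space UNIV)"
    using measurable_compose[OF * measurable_fst] by simp
  show "R s \<in> borel_measurable (past M act R t)"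
    using measurable_compose[OF * measurable_snd] by simp
qed

lemma past_action_coordinates:
  assumes "t \<ge> 1"
  shows "subalgebra (past_action M act R t) (past M act R t)"
    and "act t \<in> measurable (past_action M act R t) (count_space UNIV)"
proof -
  have *: "(\<lambda>w. (\<lambda>s\<in>{1..<t}. (act s w, R s w), act t w)) \<in> measurable (past_action M act R t)
       (Pi\<^sub>M {1..<t} (\<lambda>_. count_space UNIV \<Otimes>\<^sub>M borel) \<Otimes>\<^sub>M count_space UNIV)"
    unfolding past_action_def
    using measurable_space[OF measurable_Pair[OF history_measurable act_measurable[OF assms]]]
    by (intro measurable_vimage_algebra1) auto
  show "act t \<in> measurable (past_action M act R t) (count_space UNIV)"
    using measurable_compose[OF * measurable_snd] by simp
  have h: "(\<lambda>w. \<lambda>s\<in>{1..<t}. (act s w, R s w)) \<in> measurable (past_action M act R t)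
       (Pi\<^sub>M {1..<t} (\<lambda>_. count_space UNIV \<Otimes>\<^sub>M borel))"
    using measurable_compose[OF * measurable_fst] by simp
  show "subalgebra (past_action M act R t) (past M act R t)"
    unfolding subalgebra_def
  proof
    show "sets (past M act R t) \<subseteq> sets (past_action M act R t)"
      unfolding past_def by (rule sets_image_in_sets[OF space_past_action h])
  qed simp
qed

text \<open>The parameter of round \<open>t\<close> is a measurable function of the rounds before
  \<open>t\<close>. Since \<open>past\<close> at \<open>n\<close> records rounds below
  \<open>n\<close>, the case \<open>t = n\<close> is included.\<close>

lemma theta_measurable_past:
  assumes "1 \<le> t" "t \<le> n"
  shows "theta t \<in> borel_measurable (past M act R n)"
  using assms
proof (induction t rule: nat_induct_at_least)
  case base
  have "(\<lambda>w. theta1) \<in> borel_measurable (past M act R n)" by simp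
  then show ?case by (rule measurable_cong[THEN iffD1, rotated]) (use theta_init in simp)
next
  case (Suc t)
  have [measurable]: "theta t \<in> borel_measurable (past M act R n)"
    "act t \<in> measurable (past M act R n) (count_space UNIV)" "R t \<in> borel_measurable (past M act R n)"
    using Suc past_coordinates[of t n] by auto
  have "(\<lambda>w. theta t w + (eta * R t w) *\<^sub>R (X $ act t w - (\<Sum>c\<in>UNIV. policy X (theta t w) $ c *\<^sub>R X $ c)))
      \<in> borel_measurable (past M act R n)"
    unfolding policy_nth by measurable
  then show ?case
    by (rule measurable_cong[THEN iffD1, rotated]) (use Suc theta_Suc in simp)
qed

lemma policy_measurable_past:
  assumes "1 \<le> t" "t \<le> n"
  shows "(\<lambda>w. policy X (theta t w) $ a) \<in> borel_measurable (past M act R n)"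
proof -
  note [measurable] = theta_measurable_past[OF assms]
  show ?thesis unfolding policy_nth by measurable
qed

text \<open>\<open>U\<close> is a legitimate test function for conditioning on the past, so the
  indicator may be replaced by its conditional expectation, which \<open>act_law\<close>
  identifies.\<close>

lemma expectation_action:
  assumes t: "t \<ge> 1" and U: "U \<in> borel_measurable (past M act R t)" "integrable M U"
  shows "(\<integral>w. U w * indicator {b} (act t w) \<partial>M) = (\<integral>w. U w * policy X (theta t w) $ b \<partial>M)"
proof -
  interpret finite_measure_subalgebra M "past M act R t"
    by unfold_locales (rule subalgebra_past)
  note [measurable] = act_measurable[OF t]
  have m: "(\<lambda>w. indicator {b} (act t w) :: real) \<in> borel_measurable M" by measurable
  have int: "integrable M (\<lambda>w. U w * indicator {b} (act t w))"
    by (rule integrable_mult_AE_bounded[OF U(2) m, of 1]) (simp add: indicator_def)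
  have "(\<integral>w. U w * indicator {b} (act t w) \<partial>M)
      = (\<integral>w. U w * real_cond_exp M (past M act R t) (\<lambda>w. indicator {b} (act t w)) w \<partial>M)"
    by (rule real_cond_exp_intg(2)[symmetric]) (use int U m in auto)
  also have "\<dots> = (\<integral>w. U w * policy X (theta t w) $ b \<partial>M)"
  proof (rule integral_cong_AE)
    note [measurable] = measurable_from_subalg[OF subalgebra_past U(1)]
      measurable_from_subalg[OF subalgebra_past policy_measurable_past[OF t order_refl]]
    show "(\<lambda>w. U w * policy X (theta t w) $ b) \<in> borel_measurable M" by measurable
    show "(\<lambda>w. U w * real_cond_exp M (past M act R t) (\<lambda>w. indicator {b} (act t w)) w) \<in> borel_measurable M"
      by (intro borel_measurable_times borel_measurable_cond_exp2) measurable
    show "AE w in M. U w * real_cond_exp M (past M act R t) (\<lambda>w. indicator {b} (act t w)) w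
        = U w * policy X (theta t w) $ b"
      using act_law[OF t, of b] by eventually_elim simp
  qed
  finally show ?thesis .
qed

text \<open>\<open>R_law\<close> speaks of probabilities of sets given the past and the action,
  whereas a mean given the past alone is wanted. On a past event intersected with
  \<open>act t w = b\<close>, the reward has law \<open>P b\<close> up to the mass of the event;
  integrating the identity and then averaging over the action gives the product.\<close>

lemma cond_exp_reward:
  assumes t: "t \<ge> 1" and P: "prob_space (P b)" "sets (P b) = sets borel"
    and bnd: "AE w in M. \<bar>R t w\<bar> \<le> B"
  shows "AE w in M. real_cond_exp M (past M act R t) (\<lambda>w. indicator {b} (act t w) * R t w) w
    = policy X (theta t w) $ b * (\<integral>x. x \<partial>P b)"
proof -
  interpret finite_measure_subalgebra M "past M act R t"
    by unfold_locales (rule subalgebra_past)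
  interpret PA: finite_measure_subalgebra M "past_action M act R t"
    by unfold_locales (rule subalgebra_past_action[OF t])
  interpret Pb: prob_space "P b" by (rule P)
  note [measurable] = act_measurable[OF t] R_measurable[OF t]
    measurable_from_subalg[OF subalgebra_past policy_measurable_past[of t t b]]
  note [measurable_cong] = P(2)
  let ?m = "\<integral>x. x \<partial>P b"
  have intb: "integrable M (\<lambda>w. indicator {b} (act t w) :: real)"
    by (rule integrable_const_bound[of _ 1]) (auto simp: indicator_def)
  have intR: "integrable M (\<lambda>w. indicator {b} (act t w) * R t w)"
    by (rule integrable_mult_AE_bounded[OF intb _ bnd]) measurable
  have pol: "AE w in M. \<bar>policy X (theta t w) $ b\<bar> \<le> 1"
    by (simp add: abs_of_pos policy_pos policy_le_1)
  have pm: "(\<lambda>w. policy X (theta t w) $ b) \<in> borel_measurable (past M act R t)"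
    using policy_measurable_past t by simp
  have intp: "integrable M (\<lambda>w. policy X (theta t w) $ b)"
    using pol t by (intro integrable_const_bound[of _ 1]) (auto intro: measurable_from_subalg[OF subalg pm])
  show ?thesis
  proof (rule real_cond_exp_charact)
    fix A assume A: "A \<in> sets (past M act R t)"
    have AM[measurable]: "A \<in> sets M" using A subalgebra_past by (auto simp: subalgebra_def)
    define E where "E = {w \<in> space M. w \<in> A \<and> act t w = b}"
    have EM[measurable]: "E \<in> sets M" unfolding E_def by measurable
    have "E = A \<inter> (act t -` {b} \<inter> space (past_action M act R t))"
      using sets.sets_into_space[OF AM] by (auto simp: E_def)
    moreover have "A \<in> sets (past_action M act R t)"
      using A past_action_coordinates(1)[OF t] by (auto simp: subalgebra_def)
    moreover have "act t -` {b} \<inter> space (past_action M act R t) \<in> sets (past_action M act R t)"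
      by (rule measurable_sets[OF past_action_coordinates(2)[OF t]]) simp
    ultimately have EP: "E \<in> sets (past_action M act R t)" by auto
    \<comment> \<open>On \<open>E\<close> the action is \<open>b\<close>, so the random law in
      \<open>R_law\<close> is the fixed measure \<open>P b\<close> there.\<close>
    have joint: "prob (E \<inter> (R t -` S \<inter> space M)) = prob E * measure (P b) S" if S: "S \<in> sets borel" for S
    proof -
      have [measurable]: "S \<in> sets borel" by fact
      have "prob (E \<inter> (R t -` S \<inter> space M)) = (\<integral>w. indicator (E \<inter> (R t -` S \<inter> space M)) w \<partial>M)"
        by simp
      also have "\<dots> = (\<integral>w. indicator E w * indicator S (R t w) \<partial>M)"
        by (intro Bochner_Integration.integral_cong) (auto simp: indicator_def)
      also have "\<dots> = (\<integral>w. indicator E w * real_cond_exp M (past_action M act R t) (\<lambda>w. indicator S (R t w)) w \<partial>M)"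
      proof (rule PA.real_cond_exp_intg(2)[symmetric])
        show "integrable M (\<lambda>w. indicator E w * indicator S (R t w) :: real)"
          by (rule integrable_const_bound[of _ 1]) (auto simp: indicator_def)
        show "(indicator E :: 'w \<Rightarrow> real) \<in> borel_measurable (past_action M act R t)"
          using EP by simp
      qed measurable
      also have "\<dots> = (\<integral>w. indicator E w * measure (P b) S \<partial>M)"
      proof (rule integral_cong_AE)
        show "(\<lambda>w. indicator E w * real_cond_exp M (past_action M act R t) (\<lambda>w. indicator S (R t w)) w) \<in> borel_measurable M"
          by (intro borel_measurable_times borel_measurable_cond_exp2) auto
        show "AE w in M. indicator E w * real_cond_exp M (past_action M act R t) (\<lambda>w. indicator S (R t w)) w
            = indicator E w * measure (P b) S"
          using R_law[OF t S] by eventually_elim (auto simp: E_def indicator_def)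
      qed measurable
      also have "\<dots> = prob E * measure (P b) S" by simp
      finally show ?thesis .
    qed
    \<comment> \<open>Agreement on all Borel sets becomes an equality of measures, and hence of
      their means.\<close>
    have "distr (density M (indicator E)) borel (R t) = density (P b) (\<lambda>_. ennreal (prob E))"
    proof (rule measure_eqI)
      fix S assume "S \<in> sets (distr (density M (indicator E)) borel (R t))"
      then have S[measurable]: "S \<in> sets borel" by simp
      have "emeasure (distr (density M (indicator E)) borel (R t)) S = emeasure M (E \<inter> (R t -` S \<inter> space M))"
        by (simp add: emeasure_distr emeasure_density nn_integral_indicator flip: indicator_inter_arith)
      also have "\<dots> = ennreal (prob E) * emeasure (P b) S"
        by (simp add: emeasure_eq_measure Pb.emeasure_eq_measure joint ennreal_mult)
      finally show "emeasure (distr (density M (indicator E)) borel (R t)) S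
          = emeasure (density (P b) (\<lambda>_. ennreal (prob E))) S"
        by (simp add: emeasure_density_const P)
    qed (simp add: P)
    then have "(\<integral>x. x \<partial>distr (density M (indicator E)) borel (R t)) = (\<integral>x. x \<partial>density (P b) (\<lambda>_. ennreal (prob E)))"
      by simp
    moreover have "(\<integral>x. x \<partial>density (P b) (\<lambda>_. ennreal (prob E))) = prob E * ?m"
      by (subst integral_density) auto
    moreover have "(\<integral>x. x \<partial>distr (density M (indicator E)) borel (R t)) = (\<integral>w. indicator E w * R t w \<partial>M)"
    proof -
      have "density M (indicator E) = density M (\<lambda>w. ennreal (indicator E w))"
        by (simp add: ennreal_indicator)
      then show ?thesis
        by (simp add: integral_distr integral_density)
    qed
    ultimately have E: "(\<integral>w. indicator E w * R t w \<partial>M) = prob E * ?m" by simp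
    have "(\<integral>w\<in>A. indicator {b} (act t w) * R t w \<partial>M) = (\<integral>w. indicator E w * R t w \<partial>M)"
      unfolding set_lebesgue_integral_def
      by (intro Bochner_Integration.integral_cong) (auto simp: E_def indicator_def)
    also have "\<dots> = (\<integral>w. indicator A w * indicator {b} (act t w) \<partial>M) * ?m"
    proof -
      have "prob E = (\<integral>w. indicator E w \<partial>M)" by simp
      also have "\<dots> = (\<integral>w. indicator A w * indicator {b} (act t w) \<partial>M)"
        by (intro Bochner_Integration.integral_cong) (auto simp: E_def indicator_def)
      finally show ?thesis using E by simp
    qed
    also have "\<dots> = (\<integral>w. indicator A w * policy X (theta t w) $ b \<partial>M) * ?m"
      using A by (subst expectation_action[OF t]) (auto intro: integrable_real_indicator simp: emeasure_eq_measure)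
    also have "\<dots> = (\<integral>w\<in>A. policy X (theta t w) $ b * ?m \<partial>M)"
    proof -
      have "(\<integral>w\<in>A. policy X (theta t w) $ b * ?m \<partial>M)
          = (\<integral>w. (indicator A w * policy X (theta t w) $ b) * ?m \<partial>M)"
        unfolding set_lebesgue_integral_def
        by (intro Bochner_Integration.integral_cong) (simp_all add: mult.assoc)
      then show ?thesis by (simp only: integral_mult_left_zero)
    qed
    finally show "(\<integral>w\<in>A. indicator {b} (act t w) * R t w \<partial>M) = (\<integral>w\<in>A. policy X (theta t w) $ b * ?m \<partial>M)" .
  next
    show "(\<lambda>w. policy X (theta t w) $ b * ?m) \<in> borel_measurable (past M act R t)"
      using pm by simp
    show "integrable M (\<lambda>w. indicator {b} (act t w) * R t w)" by (rule intR)
    show "integrable M (\<lambda>w. policy X (theta t w) $ b * ?m)"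
      by (rule integrable_mult_left[OF intp])
  qed
qed

section \<open>Almost sure lower bounds on logit gaps\<close>

text \<open>The quadratic bound on \<open>exp\<close> is integrated against a nonnegative weight
  \<open>U\<close> known from the past. Linear and quadratic terms then become the conditional drift
  \<open>wcov\<close> and a bound on the conditional second moment in terms of
  \<open>wvar\<close>.\<close>

lemma exp_increment:
  fixes y :: "real ^ 'd" and G l B t
  defines "g \<equiv> \<lambda>a. X $ a \<bullet> y"
  defines "q \<equiv> \<lambda>w a. policy X (theta t w) $ a"
  defines "delta \<equiv> \<lambda>w. eta * R t w * (g (act t w) - (\<Sum>b\<in>UNIV. q w b * g b))"
  defines "mu \<equiv> \<lambda>b. \<integral>x. x \<partial>P b"
  assumes t: "t \<ge> 1"
    and P: "\<And>b. prob_space (P b)" "\<And>b. sets (P b) = sets borel"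
    and bnd: "AE w in M. \<bar>R t w\<bar> \<le> B"
    and eta: "eta > 0" and B: "B > 0" and G: "G > 0" "\<And>a b. \<bar>g a - g b\<bar> \<le> G"
    and l: "l > 0" "l * (eta * B * G) \<le> 1"
    and U: "U \<in> borel_measurable (past M act R t)" "integrable M U" "\<And>w. U w \<ge> 0"
  shows "integrable M (\<lambda>w. U w * exp (- l * delta w))"
    and "integrable M (\<lambda>w. U w * (1 - l * (eta * wcov (q w) mu g) + l\<^sup>2 * ((eta * B)\<^sup>2 * wvar (q w) g)))"
    and "(\<integral>w. U w * exp (- l * delta w) \<partial>M)
      \<le> (\<integral>w. U w * (1 - l * (eta * wcov (q w) mu g) + l\<^sup>2 * ((eta * B)\<^sup>2 * wvar (q w) g)) \<partial>M)"
proof -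
  interpret finite_measure_subalgebra M "past M act R t"
    by unfold_locales (rule subalgebra_past)
  note [measurable] = act_measurable[OF t] R_measurable[OF t]
  have qpast: "(\<lambda>w. q w a) \<in> borel_measurable (past M act R t)" for a
    unfolding q_def using policy_measurable_past t by simp
  have qM[measurable]: "(\<lambda>w. q w a) \<in> borel_measurable M" for a
    by (rule measurable_from_subalg[OF subalg qpast])
  have UM[measurable]: "U \<in> borel_measurable M" by (rule measurable_from_subalg[OF subalg U(1)])
  have gm[measurable]: "(\<lambda>w. g (act t w)) \<in> borel_measurable M"
    by (rule measurable_compose[OF act_measurable[OF t]]) simp
  define m where "m w = (\<Sum>b\<in>UNIV. q w b * g b)" for w
  have mM[measurable]: "m \<in> borel_measurable M" unfolding m_def by measurable
  have mpast: "m \<in> borel_measurable (past M act R t)"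
    unfolding m_def using qpast by (intro borel_measurable_sum borel_measurable_times) auto
  have q: "q w a \<ge> 0" "(\<Sum>a\<in>UNIV. q w a) = 1" for w a
    using policy_sum by (auto simp: q_def policy_pos[THEN less_imp_le])
  have gm_le: "\<bar>g a - m w\<bar> \<le> G" for a w
    unfolding m_def by (rule weighted_mean_dist) (use q G in auto)
  have delta: "delta w = eta * R t w * (g (act t w) - m w)" for w by (simp add: delta_def m_def)
  have deltaM[measurable]: "delta \<in> borel_measurable M" unfolding delta by measurable
  have ldelta: "AE w in M. \<bar>l * delta w\<bar> \<le> 1"
    using bnd
  proof eventually_elim
    case (elim w)
    have "\<bar>delta w\<bar> \<le> eta * B * G"
      unfolding delta abs_mult using elim eta gm_le B by (intro mult_mono) auto
    then have "l * \<bar>delta w\<bar> \<le> l * (eta * B * G)" using l by (intro mult_left_mono) auto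
    also have "\<dots> \<le> 1" by (rule l)
    finally show ?case using l by (simp add: abs_mult)
  qed
  show int1: "integrable M (\<lambda>w. U w * exp (- l * delta w))"
  proof (rule integrable_mult_AE_bounded[OF U(2), of _ "exp 1"])
    show "AE w in M. \<bar>exp (- l * delta w)\<bar> \<le> exp 1"
      using ldelta by eventually_elim (simp add: abs_le_iff)
  qed measurable
  \<comment> \<open>Replacing the squared reward by \<open>B\<^sup>2\<close> leaves a quantity whose
    only fresh randomness is the action, so \<open>act_law\<close> alone determines its conditional
    mean.\<close>
  define S where "S w = (eta * B)\<^sup>2 * (g (act t w) - m w)\<^sup>2" for w
  have SM[measurable]: "S \<in> borel_measurable M" unfolding S_def by measurable
  have intd: "integrable M (\<lambda>w. U w * delta w)"
  proof (rule integrable_mult_AE_bounded[OF U(2), of _ "1 / l"])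
    show "AE w in M. \<bar>delta w\<bar> \<le> 1 / l"
      using ldelta by eventually_elim (use l in \<open>simp add: abs_mult field_simps\<close>)
  qed measurable
  have intS: "integrable M (\<lambda>w. U w * S w)"
  proof (rule integrable_mult_AE_bounded[OF U(2), of _ "(eta * B)\<^sup>2 * G\<^sup>2"])
    show "AE w in M. \<bar>S w\<bar> \<le> (eta * B)\<^sup>2 * G\<^sup>2"
    proof (rule AE_I2)
      fix w
      have "(g (act t w) - m w)\<^sup>2 \<le> G\<^sup>2" using gm_le G by (simp add: abs_le_square_iff[symmetric])
      then show "\<bar>S w\<bar> \<le> (eta * B)\<^sup>2 * G\<^sup>2" by (simp add: S_def abs_mult mult_left_mono)
    qed
  qed measurable
  have Ed: "integrable M (\<lambda>w. U w * (eta * wcov (q w) mu g))"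
    "(\<integral>w. U w * delta w \<partial>M) = (\<integral>w. U w * (eta * wcov (q w) mu g) \<partial>M)"
  proof -
    let ?f = "\<lambda>b w. U w * (eta * (g b - m w))"
    let ?h = "\<lambda>b w. indicator {b} (act t w) * R t w"
    have fp: "?f b \<in> borel_measurable (past M act R t)" for b
      using U(1) mpast by (intro borel_measurable_times borel_measurable_diff) auto
    have fi: "integrable M (?f b)" for b
    proof (rule integrable_mult_AE_bounded[OF U(2), of _ "eta * G"])
      show "AE w in M. \<bar>eta * (g b - m w)\<bar> \<le> eta * G"
        using gm_le eta by (simp add: abs_mult mult_left_mono)
    qed measurable
    have hi: "integrable M (\<lambda>w. ?f b w * ?h b w)" for b
    proof (rule integrable_mult_AE_bounded[OF fi, of _ B])
      show "AE w in M. \<bar>?h b w\<bar> \<le> B"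
        using bnd by eventually_elim (use B in \<open>simp add: indicator_def\<close>)
    qed measurable
    have step: "integrable M (\<lambda>w. ?f b w * (q w b * mu b))"
      "(\<integral>w. ?f b w * ?h b w \<partial>M) = (\<integral>w. ?f b w * (q w b * mu b) \<partial>M)" for b
    proof -
      have hm: "?h b \<in> borel_measurable M" by measurable
      note ce = cond_exp_reward[OF t P(1) P(2) bnd, of b]
      have cM: "(\<lambda>w. ?f b w * real_cond_exp M (past M act R t) (?h b) w) \<in> borel_measurable M"
        by (intro borel_measurable_times borel_measurable_cond_exp2) measurable
      have eq: "AE w in M. ?f b w * real_cond_exp M (past M act R t) (?h b) w = ?f b w * (q w b * mu b)"
        using ce by eventually_elim (simp add: q_def mu_def)
      have rM: "(\<lambda>w. ?f b w * (q w b * mu b)) \<in> borel_measurable M" by measurable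
      note r = real_cond_exp_intg[OF hi fp hm]
      show "integrable M (\<lambda>w. ?f b w * (q w b * mu b))"
        using integrable_cong_AE[OF cM rM eq] r(1) by simp
      show "(\<integral>w. ?f b w * ?h b w \<partial>M) = (\<integral>w. ?f b w * (q w b * mu b) \<partial>M)"
        using integral_cong_AE[OF cM rM eq] r(2) by simp
    qed
    \<comment> \<open>Splitting by the sampled action separates a factor known from the past,
      \<open>?f b\<close>, from the fresh factor \<open>?h b\<close>, whose conditional mean is
      known.\<close>
    have dsum: "U w * delta w = (\<Sum>b\<in>UNIV. ?f b w * ?h b w)" for w
    proof -
      have "(\<Sum>b\<in>UNIV. ?f b w * ?h b w) = (\<Sum>b\<in>UNIV. if b = act t w then ?f b w * R t w else 0)"
        by (intro sum.cong) (auto simp: indicator_def)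
      then show ?thesis by (simp add: delta)
    qed
    have csum: "U w * (eta * wcov (q w) mu g) = (\<Sum>b\<in>UNIV. ?f b w * (q w b * mu b))" for w
      by (simp add: wcov_def m_def sum_distrib_left mult_ac)
    show "integrable M (\<lambda>w. U w * (eta * wcov (q w) mu g))"
      unfolding csum by (rule Bochner_Integration.integrable_sum) (rule step)
    show "(\<integral>w. U w * delta w \<partial>M) = (\<integral>w. U w * (eta * wcov (q w) mu g) \<partial>M)"
      unfolding csum dsum
      by (simp only: Bochner_Integration.integral_sum[OF hi] Bochner_Integration.integral_sum[OF step(1)] step(2))
  qed
  have ES: "integrable M (\<lambda>w. U w * ((eta * B)\<^sup>2 * wvar (q w) g))"
    "(\<integral>w. U w * S w \<partial>M) = (\<integral>w. U w * ((eta * B)\<^sup>2 * wvar (q w) g) \<partial>M)"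
  proof -
    let ?f = "\<lambda>b w. U w * ((eta * B)\<^sup>2 * (g b - m w)\<^sup>2)"
    have fp: "?f b \<in> borel_measurable (past M act R t)" for b
      using U(1) mpast by (intro borel_measurable_times borel_measurable_diff borel_measurable_power) auto
    have fi: "integrable M (?f b)" for b
    proof (rule integrable_mult_AE_bounded[OF U(2), of _ "(eta * B)\<^sup>2 * G\<^sup>2"])
      have "(g b - m w)\<^sup>2 \<le> G\<^sup>2" for w using gm_le G by (simp add: abs_le_square_iff[symmetric])
      then show "AE w in M. \<bar>(eta * B)\<^sup>2 * (g b - m w)\<^sup>2\<bar> \<le> (eta * B)\<^sup>2 * G\<^sup>2"
        by (simp add: abs_mult mult_left_mono)
    qed measurable
    have hi: "integrable M (\<lambda>w. ?f b w * indicator {b} (act t w))" for b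
      by (rule integrable_mult_AE_bounded[OF fi, of _ 1]) (auto simp: indicator_def)
    have qi: "integrable M (\<lambda>w. ?f b w * q w b)" for b
      by (rule integrable_mult_AE_bounded[OF fi, of _ 1])
        (auto simp: q_def policy_le_1 abs_of_pos policy_pos qM[unfolded q_def])
    have ea: "(\<integral>w. ?f b w * indicator {b} (act t w) \<partial>M) = (\<integral>w. ?f b w * q w b \<partial>M)" for b
      unfolding q_def by (rule expectation_action[OF t fp fi])
    have dsum: "U w * S w = (\<Sum>b\<in>UNIV. ?f b w * indicator {b} (act t w))" for w
    proof -
      have "(\<Sum>b\<in>UNIV. ?f b w * indicator {b} (act t w)) = (\<Sum>b\<in>UNIV. if b = act t w then ?f b w else 0)"
        by (intro sum.cong) (auto simp: indicator_def)
      then show ?thesis by (simp add: S_def)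
    qed
    have csum: "U w * ((eta * B)\<^sup>2 * wvar (q w) g) = (\<Sum>b\<in>UNIV. ?f b w * q w b)" for w
      by (simp add: wvar_def m_def sum_distrib_left mult_ac)
    show "integrable M (\<lambda>w. U w * ((eta * B)\<^sup>2 * wvar (q w) g))"
      unfolding csum by (rule Bochner_Integration.integrable_sum) (rule qi)
    show "(\<integral>w. U w * S w \<partial>M) = (\<integral>w. U w * ((eta * B)\<^sup>2 * wvar (q w) g) \<partial>M)"
      unfolding csum dsum
      by (simp only: Bochner_Integration.integral_sum[OF hi] Bochner_Integration.integral_sum[OF qi] ea)
  qed
  have expand: "U w * (1 - l * (eta * wcov (q w) mu g) + l\<^sup>2 * ((eta * B)\<^sup>2 * wvar (q w) g))
      = U w - l * (U w * (eta * wcov (q w) mu g)) + l\<^sup>2 * (U w * ((eta * B)\<^sup>2 * wvar (q w) g))" for w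
    by (simp add: algebra_simps)
  show "integrable M (\<lambda>w. U w * (1 - l * (eta * wcov (q w) mu g) + l\<^sup>2 * ((eta * B)\<^sup>2 * wvar (q w) g)))"
    unfolding expand using U(2) Ed(1) ES(1) by simp
  have "(\<integral>w. U w * exp (- l * delta w) \<partial>M) \<le> (\<integral>w. U w - l * (U w * delta w) + l\<^sup>2 * (U w * S w) \<partial>M)"
  proof (rule integral_mono_AE)
    show "AE w in M. U w * exp (- l * delta w) \<le> U w - l * (U w * delta w) + l\<^sup>2 * (U w * S w)"
      using ldelta bnd
    proof eventually_elim
      case (elim w)
      have "exp (- l * delta w) \<le> 1 + (- l * delta w) + (- l * delta w)\<^sup>2"
        using elim by (intro exp_le_quadratic) (auto simp: abs_le_iff)
      moreover have "(delta w)\<^sup>2 \<le> S w"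
      proof -
        have "(R t w)\<^sup>2 \<le> B\<^sup>2" using elim B by (simp add: abs_le_square_iff[symmetric])
        then show ?thesis by (simp add: delta S_def power_mult_distrib mult_left_mono mult_right_mono)
      qed
      then have "(- l * delta w)\<^sup>2 \<le> l\<^sup>2 * S w" by (simp add: power_mult_distrib mult_left_mono)
      ultimately have "exp (- l * delta w) \<le> 1 - l * delta w + l\<^sup>2 * S w" by simp
      then have "U w * exp (- l * delta w) \<le> U w * (1 - l * delta w + l\<^sup>2 * S w)"
        using U(3) by (rule mult_left_mono)
      then show ?case by (simp add: algebra_simps)
    qed
  qed (intro int1 U(2) intd intS Bochner_Integration.integrable_add Bochner_Integration.integrable_diff
      integrable_mult_right)+
  also have "\<dots> = (\<integral>w. U w \<partial>M) - l * (\<integral>w. U w * delta w \<partial>M) + l\<^sup>2 * (\<integral>w. U w * S w \<partial>M)"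
    using U(2) intd intS by simp
  also have "\<dots> = (\<integral>w. U w - l * (U w * (eta * wcov (q w) mu g))
      + l\<^sup>2 * (U w * ((eta * B)\<^sup>2 * wvar (q w) g)) \<partial>M)"
    unfolding Ed(2) ES(2) using U(2) Ed(1) ES(1) by simp
  also have "\<dots> = (\<integral>w. U w * (1 - l * (eta * wcov (q w) mu g) + l\<^sup>2 * ((eta * B)\<^sup>2 * wvar (q w) g)) \<partial>M)"
    by (simp only: expand)
  finally show "(\<integral>w. U w * exp (- l * delta w) \<partial>M)
      \<le> (\<integral>w. U w * (1 - l * (eta * wcov (q w) mu g) + l\<^sup>2 * ((eta * B)\<^sup>2 * wvar (q w) g)) \<partial>M)" .
qed

text \<open>The conditional probability of leaving the interval is zero almost surely, and its
  expectation is the unconditional probability.\<close>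

lemma reward_bounded:
  assumes t: "t \<ge> 1" and P: "\<And>a. measure (P a) (- {-B..B}) = 0"
  shows "AE w in M. \<bar>R t w\<bar> \<le> B"
proof -
  interpret finite_measure_subalgebra M "past_action M act R t"
    by unfold_locales (rule subalgebra_past_action[OF t])
  note [measurable] = R_measurable[OF t]
  let ?i = "\<lambda>w. indicator (- {-B..B}) (R t w) :: real"
  have int: "integrable M ?i"
    by (rule integrable_const_bound[of _ 1]) (auto simp: indicator_def)
  have "(\<integral>w. ?i w \<partial>M) = (\<integral>w. real_cond_exp M (past_action M act R t) ?i w \<partial>M)"
    by (rule real_cond_exp_int(2)[OF int, symmetric])
  also have "\<dots> = (\<integral>w. 0 \<partial>M)"
    using R_law[OF t, of "- {-B..B}"] P by (intro integral_cong_AE) auto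
  finally have "AE w in M. ?i w = 0"
    using integral_nonneg_eq_0_iff_AE[OF int] by simp
  then show ?thesis by eventually_elim (auto simp: indicator_def abs_le_iff split: if_splits)
qed

text \<open>The exponential of \<open>- l\<close> times the logit, compensated by drift and
  variance, is a nonnegative supermartingale. Its almost sure boundedness becomes the claim after
  taking logarithms and dividing by \<open>l\<close>.\<close>

lemma trajectory_lower_bound:
  fixes y :: "real ^ 'd" and G l B
  defines "g \<equiv> \<lambda>a. X $ a \<bullet> y"
  defines "q \<equiv> \<lambda>t w a. policy X (theta t w) $ a"
  defines "mu \<equiv> \<lambda>b. \<integral>x. x \<partial>P b"
  assumes P: "\<And>b. prob_space (P b)" "\<And>b. sets (P b) = sets borel"
    and bnd: "\<And>t. t \<ge> 1 \<Longrightarrow> AE w in M. \<bar>R t w\<bar> \<le> B"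
    and eta: "eta > 0" and B: "B > 0" and G: "G > 0" "\<And>a b. \<bar>g a - g b\<bar> \<le> G"
    and l: "l > 0" "l * (eta * B * G) \<le> 1"
  shows "AE w in M. \<exists>L. \<forall>n. theta (Suc n) w \<bullet> y \<ge>
    - L + (\<Sum>s<n. eta * wcov (q (Suc s) w) mu g - l * ((eta * B)\<^sup>2 * wvar (q (Suc s) w) g))"
proof -
  \<comment> \<open>\<open>exp (- A s w)\<close> dominates the conditional mean of the
    multiplicative increment. The index \<open>Suc s\<close> appears because rounds start at
    \<open>1\<close>.\<close>
  define A where "A s w = l * (eta * wcov (q (Suc s) w) mu g) - l\<^sup>2 * ((eta * B)\<^sup>2 * wvar (q (Suc s) w) g)" for s w
  define W where "W n w = exp (- l * (theta (Suc n) w \<bullet> y) + (\<Sum>s<n. A s w))" for n w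
  define delta where "delta n w = eta * R (Suc n) w * (g (act (Suc n) w) - (\<Sum>b\<in>UNIV. q (Suc n) w b * g b))" for n w
  have q: "q t w a \<ge> 0" "(\<Sum>a\<in>UNIV. q t w a) = 1" for t w a
    using policy_sum by (auto simp: q_def policy_pos[THEN less_imp_le])
  have Ameas: "A s \<in> borel_measurable (past M act R (Suc n))" if "s \<le> n" for s n
  proof -
    have [measurable]: "(\<lambda>w. q (Suc s) w a) \<in> borel_measurable (past M act R (Suc n))" for a
      unfolding q_def using policy_measurable_past that by simp
    show ?thesis unfolding A_def wcov_def wvar_def by measurable
  qed
  have Wmeas: "W s \<in> borel_measurable (past M act R (Suc n))" if "s \<le> n" for s n
  proof -
    have [measurable]: "theta (Suc s) \<in> borel_measurable (past M act R (Suc n))"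
      using theta_measurable_past that by simp
    have [measurable]: "(\<lambda>w. \<Sum>i<s. A i w) \<in> borel_measurable (past M act R (Suc n))"
      using Ameas that by (intro borel_measurable_sum) auto
    show ?thesis unfolding W_def by measurable
  qed
  \<comment> \<open>An upper bound on \<open>A\<close> makes \<open>exp (A n w)\<close> a bounded
    factor, so integrability propagates from \<open>W n\<close> to \<open>W (Suc n)\<close>.\<close>
  have A_le: "A s w \<le> l * (eta * ((\<Sum>a\<in>UNIV. \<bar>mu a\<bar>) * G))" for s w
  proof -
    have "l * (eta * wcov (q (Suc s) w) mu g) \<le> l * (eta * ((\<Sum>a\<in>UNIV. \<bar>mu a\<bar>) * G))"
      using l eta q G by (intro mult_left_mono wcov_le) auto
    moreover have "l\<^sup>2 * ((eta * B)\<^sup>2 * wvar (q (Suc s) w) g) \<ge> 0"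
      using q by (intro mult_nonneg_nonneg wvar_nonneg) auto
    ultimately show ?thesis by (simp add: A_def)
  qed
  have expA: "integrable M (\<lambda>w. W n w * exp (A n w))" if "integrable M (W n)" for n
  proof (rule integrable_mult_AE_bounded[OF that])
    note [measurable] = measurable_from_subalg[OF subalgebra_past Ameas[OF order_refl, of n]]
    show "(\<lambda>w. exp (A n w)) \<in> borel_measurable M" by measurable
    show "AE w in M. \<bar>exp (A n w)\<bar> \<le> exp (l * (eta * ((\<Sum>a\<in>UNIV. \<bar>mu a\<bar>) * G)))"
      using A_le by simp
  qed
  have W_Suc: "W (Suc n) w = W n w * exp (A n w) * exp (- l * delta n w)" if "w \<in> space M" for n w
  proof -
    have "theta (Suc (Suc n)) w \<bullet> y = theta (Suc n) w \<bullet> y + delta n w"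
      using theta_Suc[OF _ that, of "Suc n"]
      by (simp add: delta_def g_def q_def inner_add_left inner_diff_left inner_sum_left)
    then show ?thesis by (simp add: W_def algebra_simps flip: exp_add)
  qed
  have inc: "integrable M (\<lambda>w. U w * exp (- l * delta n w))"
    "integrable M (\<lambda>w. U w * (1 - l * (eta * wcov (q (Suc n) w) mu g)
      + l\<^sup>2 * ((eta * B)\<^sup>2 * wvar (q (Suc n) w) g)))"
    "(\<integral>w. U w * exp (- l * delta n w) \<partial>M)
      \<le> (\<integral>w. U w * (1 - l * (eta * wcov (q (Suc n) w) mu g)
        + l\<^sup>2 * ((eta * B)\<^sup>2 * wvar (q (Suc n) w) g)) \<partial>M)"
    if U: "U \<in> borel_measurable (past M act R (Suc n))" "integrable M U" "\<And>w. U w \<ge> 0" for n U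
  proof -
    have t: "Suc n \<ge> 1" by simp
    note i = exp_increment[OF t P bnd[OF t] eta B G[unfolded g_def] l U]
    show "integrable M (\<lambda>w. U w * exp (- l * delta n w))"
      unfolding delta_def q_def g_def by (rule i(1))
    show "integrable M (\<lambda>w. U w * (1 - l * (eta * wcov (q (Suc n) w) mu g)
      + l\<^sup>2 * ((eta * B)\<^sup>2 * wvar (q (Suc n) w) g)))"
      unfolding mu_def q_def g_def by (rule i(2))
    show "(\<integral>w. U w * exp (- l * delta n w) \<partial>M)
      \<le> (\<integral>w. U w * (1 - l * (eta * wcov (q (Suc n) w) mu g)
        + l\<^sup>2 * ((eta * B)\<^sup>2 * wvar (q (Suc n) w) g)) \<partial>M)"
      unfolding delta_def mu_def q_def g_def by (rule i(3))
  qed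
  have Wpos: "W n w > 0" for n w by (simp add: W_def)
  have Wint: "integrable M (W n)" for n
  proof (induction n)
    case 0
    have "integrable M (\<lambda>w. exp (- l * (theta1 \<bullet> y)))" by simp
    then show ?case
      by (rule Bochner_Integration.integrable_cong[THEN iffD1, rotated 2]) (use theta_init in \<open>simp_all add: W_def\<close>)
  next
    case (Suc n)
    note [measurable] = Wmeas[OF order_refl, of n] Ameas[OF order_refl, of n]
    have "(\<lambda>w. W n w * exp (A n w)) \<in> borel_measurable (past M act R (Suc n))"
      by measurable
    then have "integrable M (\<lambda>w. W n w * exp (A n w) * exp (- l * delta n w))"
      using expA[OF Suc] Wpos by (intro inc) (auto simp: less_imp_le)
    then show ?case
      by (rule Bochner_Integration.integrable_cong[THEN iffD1, rotated 2]) (simp_all add: W_Suc)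
  qed
  have "AE w in M. \<exists>C. \<forall>n. W n w \<le> C"
  proof (rule nonneg_supermartingale_bounded)
    fix n a
    let ?N = "{w \<in> space M. \<forall>s\<le>n. W s w < a}"
    \<comment> \<open>Everything in \<open>?U\<close>, the stopping indicator included, depends only
      on rounds before \<open>Suc n\<close>, so the one-step estimate applies with this
      weight.\<close>
    let ?U = "\<lambda>w. W n w * exp (A n w) * indicator ?N w"
    have N: "?N \<in> sets (past M act R (Suc n))"
    proof -
      have "(\<Inter>s\<in>{..n}. {w \<in> space (past M act R (Suc n)). W s w < a}) \<in> sets (past M act R (Suc n))"
        using Wmeas by (intro sets.finite_INT borel_measurable_less) auto
      also have "(\<Inter>s\<in>{..n}. {w \<in> space (past M act R (Suc n)). W s w < a}) = ?N" by auto
      finally show ?thesis .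
    qed
    have NM: "?N \<in> sets M"
      using subalgebra_past[of "Suc n"] N unfolding subalgebra_def by (elim conjE) (rule subsetD)
    have U: "?U \<in> borel_measurable (past M act R (Suc n))"
    proof -
      note [measurable] = Wmeas[OF order_refl, of n] Ameas[OF order_refl, of n] N
      show ?thesis by measurable
    qed
    have Ui: "integrable M ?U"
      using integrable_mult_indicator[OF NM expA[OF Wint, of n]] by (simp add: mult.commute)
    have U0: "?U w \<ge> 0" for w using Wpos[of n w] by (simp add: less_imp_le)
    have Wi: "integrable M (\<lambda>w. W n w * indicator ?N w)"
      using integrable_mult_indicator[OF NM Wint[of n]] by (simp add: mult.commute)
    have "(\<integral>w. W (Suc n) w * indicator ?N w \<partial>M) = (\<integral>w. ?U w * exp (- l * delta n w) \<partial>M)"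
      by (intro Bochner_Integration.integral_cong refl) (simp add: W_Suc)
    also have "\<dots> \<le> (\<integral>w. ?U w * (1 - l * (eta * wcov (q (Suc n) w) mu g)
        + l\<^sup>2 * ((eta * B)\<^sup>2 * wvar (q (Suc n) w) g)) \<partial>M)"
      using U Ui U0 by (intro inc) auto
    also have "\<dots> \<le> (\<integral>w. W n w * indicator ?N w \<partial>M)"
    proof (rule integral_mono)
      show "integrable M (\<lambda>w. ?U w * (1 - l * (eta * wcov (q (Suc n) w) mu g)
        + l\<^sup>2 * ((eta * B)\<^sup>2 * wvar (q (Suc n) w) g)))"
        using U Ui U0 by (intro inc) auto
      fix w
      \<comment> \<open>By \<open>1 + x \<le> exp x\<close>, the one-step factor is at most
        \<open>exp (- A n w)\<close>, which cancels the compensator in \<open>?U\<close>.\<close>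
      have "1 - l * (eta * wcov (q (Suc n) w) mu g) + l\<^sup>2 * ((eta * B)\<^sup>2 * wvar (q (Suc n) w) g) \<le> exp (- A n w)"
      proof -
        have "1 - l * (eta * wcov (q (Suc n) w) mu g) + l\<^sup>2 * ((eta * B)\<^sup>2 * wvar (q (Suc n) w) g) = 1 + - A n w"
          unfolding A_def by simp
        then show ?thesis using exp_ge_add_one_self[of "- A n w"] by (simp only:)
      qed
      then have "?U w * (1 - l * (eta * wcov (q (Suc n) w) mu g) + l\<^sup>2 * ((eta * B)\<^sup>2 * wvar (q (Suc n) w) g))
          \<le> ?U w * exp (- A n w)"
        using U0 by (rule mult_left_mono)
      also have "\<dots> = W n w * indicator ?N w" by (simp add: exp_minus)
      finally show "?U w * (1 - l * (eta * wcov (q (Suc n) w) mu g) + l\<^sup>2 * ((eta * B)\<^sup>2 * wvar (q (Suc n) w) g))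
          \<le> W n w * indicator ?N w" .
    qed (rule Wi)
    finally show "(\<integral>w. W (Suc n) w * indicator ?N w \<partial>M) \<le> (\<integral>w. W n w * indicator ?N w \<partial>M)" .
  qed (use Wint Wpos in \<open>auto simp: less_imp_le\<close>)
  then show ?thesis
  proof eventually_elim
    case (elim w)
    then obtain C where C: "\<And>n. W n w \<le> C" by blast
    have "C > 0" using C[of 0] Wpos[of 0 w] by linarith
    have "theta (Suc n) w \<bullet> y \<ge> - (ln C / l)
      + (\<Sum>s<n. eta * wcov (q (Suc s) w) mu g - l * ((eta * B)\<^sup>2 * wvar (q (Suc s) w) g))" (is "_ \<ge> _ + ?S") for n
    proof -
      have "(\<Sum>s<n. A s w) = l * ?S"
        by (simp add: A_def sum_distrib_left right_diff_distrib power2_eq_square mult.assoc)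
      moreover have "- l * (theta (Suc n) w \<bullet> y) + (\<Sum>s<n. A s w) \<le> ln C"
        using C[of n] \<open>C > 0\<close> by (simp add: W_def ln_ge_iff)
      ultimately have "l * (?S - theta (Suc n) w \<bullet> y) \<le> ln C" by (simp add: algebra_simps)
      then have "?S - theta (Suc n) w \<bullet> y \<le> ln C / l" using l by (simp add: field_simps)
      then show ?thesis by linarith
    qed
    then show ?case by blast
  qed
qed

end

section \<open>From the feature condition to almost sure convergence of the policies\<close>

theorem theorem9:
  fixes M :: "'w measure"
    and X :: "real ^ 'd ^ ('k :: {finite, linorder})"
    and Rmax :: real and nu :: "real measure" and p :: "'k \<Rightarrow> real \<Rightarrow> ennreal"
    and r :: "'k \<Rightarrow> real" and astar :: 'k
    and Delta rho eta :: real
    and theta1 :: "real ^ 'd" and theta :: "nat \<Rightarrow> 'w \<Rightarrow> real ^ 'd"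
    and act :: "nat \<Rightarrow> 'w \<Rightarrow> 'k" and R :: "nat \<Rightarrow> 'w \<Rightarrow> real"
  assumes K_ge_2: "CARD('k) \<ge> 2"
    and d_le_K: "CARD('d) \<le> CARD('k)"
    and bandit: "bounded_bandit Rmax nu p"
    and r: "r = mean_reward nu p"
    and r_decreasing: "\<And>i j. i < j \<Longrightarrow> r i > r j"
    and astar: "astar = Min UNIV"
    and Delta: "Delta = reward_gap r"
    and features_strict: "\<And>i j k. r i > r j \<Longrightarrow> r i > r k \<Longrightarrow> i = astar \<or> j = k \<Longrightarrow>
           (X $ i - X $ j) \<bullet> (X $ astar - X $ k) > 0"
    and features_weak: "\<And>i j k. r i > r j \<Longrightarrow> r i > r k \<Longrightarrow> \<not> (i = astar \<or> j = k) \<Longrightarrow>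
           (X $ i - X $ j) \<bullet> (X $ astar - X $ k) \<ge> 0"
    and rho: "rho = 8 * Rmax ^ 3 * real CARD('k) powr (3/2) / Delta\<^sup>2"
    and eta_pos: "0 < eta"
    and eta_le: "eta \<le> min
           (1 / (6 * lambda_max (transpose X ** X) powr (3/2) * sqrt (2 * Rmax)))
           (lambda_min (transpose X ** X) / (6 * rho * (lambda_max (transpose X ** X))\<^sup>2))"
    and process: "softmax_pg M X (reward_law nu p) eta theta1 theta act R"
  shows "AE w in M. (\<lambda>t. policy X (theta t w) $ astar) \<longlonglongrightarrow> 1"
proof -
  interpret bandit: bounded_bandit Rmax nu p by (rule bandit)
  interpret softmax_pg M X "reward_law nu p" eta theta1 theta act R by (rule process)
  have P: "prob_space (reward_law nu p a)" "sets (reward_law nu p a) = sets borel" for a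
    using bandit.p_density bandit.sets_nu by (simp_all add: reward_law_def)
  have mean: "(\<lambda>b. \<integral>x. x \<partial>reward_law nu p b) = r"
    by (simp add: r mean_reward_def fun_eq_iff)
  have bnd: "AE w in M. \<bar>R t w\<bar> \<le> Rmax" if "t \<ge> 1" for t
  proof (rule reward_bounded[OF that])
    fix a
    \<comment> \<open>A measure with a density inherits the null sets of \<open>nu\<close>.\<close>
    have "p a \<in> borel_measurable nu"
      using bandit.p_measurable bandit.sets_nu by (simp cong: measurable_cong_sets)
    moreover have "- {-Rmax..Rmax} \<in> null_sets nu"
      using bandit.nu_support bandit.sets_nu by (simp add: null_sets_def)
    ultimately have "- {-Rmax..Rmax} \<in> null_sets (density nu (p a))"
      using absolutely_continuousI_density[of "p a" nu] by (auto simp: absolutely_continuous_def)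
    then show "measure (reward_law nu p a) (- {-Rmax..Rmax}) = 0"
      by (simp add: reward_law_def measure_eq_0_null_sets)
  qed
  have best: "r b < r astar" if "b \<noteq> astar" for b
    using that r_decreasing by (simp add: astar order.not_eq_order_implies_strict)
  have inj: "inj r"
    using r_decreasing by (metis injI less_irrefl linorder_neqE)
  have growth: "AE w in M. j \<noteq> astar \<longrightarrow> (\<exists>L. \<exists>c>0. \<exists>C\<ge>0. \<forall>n.
      theta (Suc n) w \<bullet> (X $ astar - X $ j) \<ge> - L + (\<Sum>s<n. (1 - policy X (theta (Suc s) w) $ astar)
        * (c * policy X (theta (Suc s) w) $ astar - C * (\<Sum>b | r b < r j. policy X (theta (Suc s) w) $ b))))" for j
  proof (cases "j = astar")
    case False
    \<comment> \<open>With \<open>k = j\<close>, the feature conditions say that \<open>g\<close> is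
      strictly largest at \<open>astar\<close> and orders \<open>a\<close> above \<open>b\<close>
      whenever \<open>a\<close> beats both \<open>b\<close> and \<open>j\<close>.\<close>
    define y where "y = X $ astar - X $ j"
    define g where "g = (\<lambda>a. X $ a \<bullet> y)"
    have strict: "g b < g astar" if "b \<noteq> astar" for b
      using features_strict[OF best[OF that] best[OF False]] by (simp add: g_def y_def inner_diff_left)
    have weak: "g a \<ge> g b" if "r a > r b" "r a > r j" for a b
      using features_strict[OF that] features_weak[OF that]
      by (cases "a = astar \<or> b = j") (simp_all add: g_def y_def inner_diff_left less_imp_le)
    obtain l0 c C where lcC: "l0 > 0" "c > 0" "C \<ge> 0"
      and drift: "\<And>l q. 0 < l \<Longrightarrow> l \<le> l0 \<Longrightarrow> (\<And>a. q a \<ge> 0) \<Longrightarrow> sum q UNIV = 1 \<Longrightarrow>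
        (1 - q astar) * (c * q astar - C * (\<Sum>b | r b < r j. q b)) \<le> wcov q r g - l * wvar q g"
      using drift_minus_variance_ge[where r = r and g = g and star = astar and j = j, OF inj best strict weak False] by blast
    obtain G where G: "G > 0" "\<And>a b. \<bar>g a - g b\<bar> \<le> G"
      using finite_ex_diff_bound[of g] by blast
    note Rpos = bandit.Rmax_pos
    \<comment> \<open>The first bound keeps the exponent increment within \<open>1\<close>. The
      second makes the variance coefficient, after a factor \<open>eta\<close> is taken out, at most
      \<open>l0\<close>.\<close>
    define l where "l = min (1 / (eta * Rmax * G)) (l0 / (eta * Rmax\<^sup>2))"
    have l: "l > 0" "l * (eta * Rmax * G) \<le> 1" "l * (eta * Rmax\<^sup>2) \<le> l0"
    proof -
      show "l > 0" using eta_pos Rpos G lcC by (simp add: l_def)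
      have "l \<le> 1 / (eta * Rmax * G)" "l \<le> l0 / (eta * Rmax\<^sup>2)" by (simp_all add: l_def)
      then show "l * (eta * Rmax * G) \<le> 1" "l * (eta * Rmax\<^sup>2) \<le> l0"
        using eta_pos Rpos G by (simp_all add: pos_le_divide_eq)
    qed
    have "AE w in M. \<exists>L. \<forall>n. theta (Suc n) w \<bullet> y \<ge>
      - L + (\<Sum>s<n. eta * wcov (\<lambda>a. policy X (theta (Suc s) w) $ a) r g
        - l * ((eta * Rmax)\<^sup>2 * wvar (\<lambda>a. policy X (theta (Suc s) w) $ a) g))"
      using trajectory_lower_bound[OF P bnd eta_pos Rpos G[unfolded g_def] l(1,2)]
      unfolding mean g_def .
    then show ?thesis
    proof eventually_elim
      case (elim w)
      then obtain L where L: "\<And>n. theta (Suc n) w \<bullet> y \<ge>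
        - L + (\<Sum>s<n. eta * wcov (\<lambda>a. policy X (theta (Suc s) w) $ a) r g
          - l * ((eta * Rmax)\<^sup>2 * wvar (\<lambda>a. policy X (theta (Suc s) w) $ a) g))" by blast
      have step: "(1 - q astar) * (eta * c * q astar - eta * C * (\<Sum>b | r b < r j. q b))
        \<le> eta * wcov q r g - l * ((eta * Rmax)\<^sup>2 * wvar q g)"
        if "\<And>a. q a \<ge> 0" "sum q UNIV = 1" for q
      proof -
        have "0 < l * (eta * Rmax\<^sup>2)" using l eta_pos Rpos by simp
        then have "eta * ((1 - q astar) * (c * q astar - C * (\<Sum>b | r b < r j. q b)))
            \<le> eta * (wcov q r g - (l * (eta * Rmax\<^sup>2)) * wvar q g)"
          using eta_pos l that by (intro mult_left_mono drift) auto
        then show ?thesis by (simp add: algebra_simps power2_eq_square)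
      qed
      have "theta (Suc n) w \<bullet> (X $ astar - X $ j) \<ge> - L + (\<Sum>s<n. (1 - policy X (theta (Suc s) w) $ astar)
        * (eta * c * policy X (theta (Suc s) w) $ astar
          - eta * C * (\<Sum>b | r b < r j. policy X (theta (Suc s) w) $ b)))" for n
        unfolding y_def[symmetric]
        by (rule order_trans[OF add_left_mono[OF sum_mono] L], rule step)
          (auto simp: policy_sum policy_pos[THEN less_imp_le])
      moreover have "eta * c > 0" "eta * C \<ge> 0" using eta_pos lcC by auto
      ultimately show ?case by blast
    qed
  qed simp
  \<comment> \<open>There are finitely many actions, so one almost sure event serves all gaps, with
    constants depending on the path.\<close>
  then have "AE w in M. \<forall>j\<in>UNIV. j \<noteq> astar \<longrightarrow> (\<exists>L. \<exists>c>0. \<exists>C\<ge>0. \<forall>n.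
      theta (Suc n) w \<bullet> (X $ astar - X $ j) \<ge> - L + (\<Sum>s<n. (1 - policy X (theta (Suc s) w) $ astar)
        * (c * policy X (theta (Suc s) w) $ astar - C * (\<Sum>b | r b < r j. policy X (theta (Suc s) w) $ b))))"
    by (intro AE_finite_allI) auto
  then show ?thesis
  proof eventually_elim
    case (elim w)
    have "(\<lambda>n. policy X (theta (Suc n) w) $ astar) \<longlonglongrightarrow> 1"
    proof (rule trajectory_convergence[where r = r and Y = "\<lambda>n j. theta (Suc n) w \<bullet> (X $ astar - X $ j)"])
      show "policy X (theta (Suc n) w) $ a = policy X (theta (Suc n) w) $ astar
          * exp (- (theta (Suc n) w \<bullet> (X $ astar - X $ a)))" for n a
        by (metis policy_ratio inner_commute)
    qed (use elim best in \<open>auto simp: policy_pos policy_sum\<close>)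
    \<comment> \<open>Undoes the shift that let sums run from \<open>0\<close> while rounds start at
      \<open>1\<close>.\<close>
    then show ?case by (rule LIMSEQ_imp_Suc)
  qed
qed

end
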